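(* Let $S=\langle g_1,\dots,g_n\rangle$ be a numerical semigroup and $R=K[[t^S]]$ with maximal ideal $\mathbf m$. Then $G(\mathbf m)$ is Buchsbaum if and only if $\overline{t^{\omega_i+lg_1}}\in(0:_{G(\mathbf m)}\mathcal M)$ for every $i\in\{0,\dots,g_1-1\}$ such that $a_i>b_i$ and for every $l=0,\dots,l_i$.
   Context: $K$ is an infinite field. A numerical semigroup $S\subseteq\mathbb N$ (with $0\in S$) has minimal generators $g_1<\dots<g_n$ with $\gcd(g_1,\dots,g_n)=1$. $R=K[[t^S]]=K[[t^{g_1},\dots,t^{g_n}]]$, $\mathbf m=(t^{g_1},\dots,t^{g_n})$, $G(\mathbf m)=\bigoplus_{i\ge0}\mathbf m^i/\mathbf m^{i+1}$, $\mathcal M$ is the homogeneous maximal ideal of $G(\mathbf m)$, and $r$ is the reduction number of $\mathbf m$, i.e. the least $r\ge 0$ with $\mathbf m^{r+1}=t^{g_1}\mathbf m^r$. $G(\mathbf m)$ is called Buchsbaum if $\mathcal M\cdot H^0_{\mathcal M}=0$, where $H^0_{\mathcal M}=\bigcup_{k\ge1}(0:_{G(\mathbf m)}\mathcal M^k)$, which equals $(0:_{G(\mathbf m)}\mathcal M^r)$. $M=S\setminus\{0\}$; $hM=M+\dots+M$ ($h$ summands), $0M=S$. For $s\in S$ with $s\in hM\setminus(h+1)M$, $\overline{t^s}$ denotes the (nonzero) class of $t^s$ in $\mathbf m^h/\mathbf m^{h+1}\subset G(\mathbf m)$. Apery set: $\mathrm{Ap}_{g_1}(S)=\{\omega_0,\dots,\omega_{g_1-1}\}$,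 where $\omega_i=\min\{s\in S: s\equiv i \bmod g_1\}$. Let $S'=\langle g_1,g_2-g_1,\dots,g_n-g_1\rangle$ and $\omega'_i=\min\{s\in S': s\equiv i\bmod g_1\}$. For $0\le i\le g_1-1$, $a_i$ is the integer with $\omega'_i+a_ig_1=\omega_i$, and $b_i=\max\{l:\omega_i\in lM\}$; one always has $b_i\le a_i$. For $i$ with $a_i>b_i$, $l_i=\max\{l\ge 0: \overline{t^{\omega_i+lg_1}}\in(0:_{G(\mathbf m)}\mathcal M^r)\}$ (this maximum exists). *)

theory Defs
  imports
    "HOL-Algebra.Algebra"
    "HOL-Algebra.Algebraic_Closure_Type"
    "HOL-Computational_Algebra.Formal_Power_Series"
begin

section \<open>Numerical semigroups\<close>

definition semigroup_span :: "nat set \<Rightarrow> nat set" where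
  "semigroup_span A = {\<Sum>a\<in>A. c a * a | c :: nat \<Rightarrow> nat. True}"

text \<open>The system \<open>g 1 < \<dots> < g n\<close>, indexed from \<open>1\<close>, is the minimal system of generators of the
  numerical semigroup that it spans. Minimality excludes the generator \<open>0\<close>, which lies in
  the span of the empty set, and the condition on the gcd excludes \<open>n = 0\<close>.\<close>

definition minimal_generators :: "(nat \<Rightarrow> nat) \<Rightarrow> nat \<Rightarrow> bool" where
  "minimal_generators g n \<longleftrightarrow>
     strict_mono_on {1..n} g \<and>
     Gcd (g ` {1..n}) = 1 \<and>
     (\<forall>i\<in>{1..n}. g i \<notin> semigroup_span (g ` ({1..n} - {i})))"

definition apery :: "nat set \<Rightarrow> nat \<Rightarrow> nat \<Rightarrow> nat" where
  "apery S e i = (LEAST s. s \<in> S \<and> s mod e = i mod e)"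

text \<open>\<open>hfold S h\<close> is the set \<open>h M\<close> for \<open>M = S - {0}\<close>, with the convention \<open>0 M = S\<close>.\<close>

definition hfold :: "nat set \<Rightarrow> nat \<Rightarrow> nat set" where
  "hfold S h =
     (if h = 0 then S else {\<Sum>j<h. x j | x :: nat \<Rightarrow> nat. \<forall>j<h. x j \<in> S - {0}})"


section \<open>Ideals and the associated graded ring\<close>

abbreviation ideal_pow :: "('a, 'b) ring_scheme \<Rightarrow> 'a set \<Rightarrow> nat \<Rightarrow> 'a set" where
  "ideal_pow R I k \<equiv> I [^]\<^bsub>ideals_set R\<^esub> k"

definition reduction_number :: "('a, 'b) ring_scheme \<Rightarrow> 'a set \<Rightarrow> 'a \<Rightarrow> nat" where
  "reduction_number R I x = (LEAST r. ideal_pow R I (r + 1) = x <#\<^bsub>R\<^esub> ideal_pow R I r)"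

definition ideal_annihilator :: "('a, 'b) ring_scheme \<Rightarrow> 'a set \<Rightarrow> 'a set" where
  "ideal_annihilator R I = {x \<in> carrier R. \<forall>y\<in>I. x \<otimes>\<^bsub>R\<^esub> y = \<zero>\<^bsub>R\<^esub>}"

text \<open>The component of degree \<open>k\<close> is the additive group \<open>I\<^sup>k / I\<^sup>k\<^sup>+\<^sup>1\<close>, written multiplicatively as
  all groups of the library are: its product is the addition of cosets, its \<open>one\<close> is the zero
  coset \<open>I\<^sup>k\<^sup>+\<^sup>1\<close>, and \<open>finprod\<close> is a sum.\<close>

definition gr_component :: "('a, 'b) ring_scheme \<Rightarrow> 'a set \<Rightarrow> nat \<Rightarrow> 'a set monoid" where
  "gr_component R I k =
     (add_monoid R)\<lparr>carrier := ideal_pow R I k\<rparr> Mod ideal_pow R I (k + 1)"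

text \<open>Elements of the direct sum are finitely supported families of cosets. The product of the
  classes of \<open>a \<in> I\<^sup>i\<close> and \<open>b \<in> I\<^sup>j\<close> is the class of \<open>a b\<close> modulo \<open>I\<^sup>i\<^sup>+\<^sup>j\<^sup>+\<^sup>1\<close>.\<close>

definition assoc_graded :: "('a, 'b) ring_scheme \<Rightarrow> 'a set \<Rightarrow> (nat \<Rightarrow> 'a set) ring" where
  "assoc_graded R I =
     \<lparr>carrier = {f. (\<forall>k. f k \<in> carrier (gr_component R I k)) \<and>
                    finite {k. f k \<noteq> \<one>\<^bsub>gr_component R I k\<^esub>}},
      monoid.mult = (\<lambda>f h k. \<Otimes>\<^bsub>gr_component R I k\<^esub>i\<in>{..k}.
                rcoset_mult R (ideal_pow R I (k + 1)) (f i) (h (k - i))),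
      one = (\<lambda>k. if k = 0 then ideal_pow R I 1 +>\<^bsub>R\<^esub> \<one>\<^bsub>R\<^esub> else \<one>\<^bsub>gr_component R I k\<^esub>),
      ring.zero = (\<lambda>k. \<one>\<^bsub>gr_component R I k\<^esub>),
      add = (\<lambda>f h k. f k \<otimes>\<^bsub>gr_component R I k\<^esub> h k)\<rparr>"

text \<open>The class of \<open>x \<in> I\<^sup>k\<close> in \<open>I\<^sup>k / I\<^sup>k\<^sup>+\<^sup>1\<close>, as a homogeneous element of degree \<open>k\<close>.\<close>

definition gr_class :: "('a, 'b) ring_scheme \<Rightarrow> 'a set \<Rightarrow> nat \<Rightarrow> 'a \<Rightarrow> (nat \<Rightarrow> 'a set)" where
  "gr_class R I k x =
     (\<lambda>j. if j = k then ideal_pow R I (k + 1) +>\<^bsub>R\<^esub> x else \<one>\<^bsub>gr_component R I j\<^esub>)"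

text \<open>The ideal of the elements of positive degree. When \<open>I\<close> is a maximal ideal, the degree-\<open>0\<close>
  part \<open>R / I\<close> is a field and this is the homogeneous maximal ideal.\<close>

definition gr_maximal :: "('a, 'b) ring_scheme \<Rightarrow> 'a set \<Rightarrow> (nat \<Rightarrow> 'a set) set" where
  "gr_maximal R I = {f \<in> carrier (assoc_graded R I). f 0 = \<one>\<^bsub>gr_component R I 0\<^esub>}"

definition local_cohomology_0 :: "('a, 'b) ring_scheme \<Rightarrow> 'a set \<Rightarrow> 'a set" where
  "local_cohomology_0 G J = (\<Union>k\<in>{1..}. ideal_annihilator G (ideal_pow G J k))"

definition buchsbaum :: "('a, 'b) ring_scheme \<Rightarrow> 'a set \<Rightarrow> bool" where
  "buchsbaum G J \<longleftrightarrow> ideal_prod G J (local_cohomology_0 G J) = {\<zero>\<^bsub>G\<^esub>}"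


section \<open>The ring of a numerical semigroup\<close>

definition semigroup_ring :: "nat set \<Rightarrow> 'k::field fps ring" where
  "semigroup_ring S = ring_of_type_algebra\<lparr>carrier := {f. \<forall>s. fps_nth f s \<noteq> 0 \<longrightarrow> s \<in> S}\<rparr>"

text \<open>The initial form of \<open>t\<^sup>s\<close>; its degree is the \<open>h\<close> with \<open>s \<in> h M\<close> and \<open>s \<notin> (h + 1) M\<close>, unique
  because the sets \<open>h M\<close> decrease.\<close>

definition monomial_class :: "nat set \<Rightarrow> 'k::field fps set \<Rightarrow> nat \<Rightarrow> (nat \<Rightarrow> 'k fps set)" where
  "monomial_class S I s =
     gr_class (semigroup_ring S) I (THE h. s \<in> hfold S h \<and> s \<notin> hfold S (h + 1)) (fps_X ^ s)"

end

theory Submission imports Defs begin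

text \<open>
  In degree \<open>h\<close>, the associated graded ring has the classes of \<open>t\<^sup>s\<close> with \<open>s\<close> of order exactly \<open>h\<close> as a
  \<open>K\<close>-basis, and the product of the classes of \<open>t\<^sup>u\<close> and \<open>t\<^sup>v\<close> is the class of \<open>t\<^sup>u\<^sup>+\<^sup>v\<close> or \<open>0\<close>, according to whether
  the orders add up. So the local cohomology module is spanned by the classes of those \<open>t\<^sup>s\<close> that are
  killed by a power of the class of \<open>t\<close> to the \<open>g 1\<close>: by the definition of \<open>r\<close>, such a class is killed
  by everything of degree at least \<open>r\<close>. The order of \<open>\<omega> i + k g 1\<close> minus \<open>k\<close> is
  non-decreasing in \<open>k\<close>, starts at \<open>b i\<close> and is eventually constant with value \<open>a i\<close>. Hence the classes in
  question are those with \<open>a i > b i\<close> and \<open>k \<le> l i\<close>, and being Buchsbaum means that all of them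
  are annihilated in degree \<open>1\<close> and above.
\<close>

subsection \<open>Numerical semigroups\<close>

lemma semigroup_span_zero: "0 \<in> semigroup_span A"
  unfolding semigroup_span_def by (intro CollectI exI[of _ "\<lambda>_. 0"]) auto

lemma semigroup_span_add:
  assumes "x \<in> semigroup_span A" "y \<in> semigroup_span A"
  shows "x + y \<in> semigroup_span A"
proof -
  obtain c d where "x = (\<Sum>a\<in>A. c a * a)" "y = (\<Sum>a\<in>A. d a * a)"
    using assms unfolding semigroup_span_def by blast
  then have "x + y = (\<Sum>a\<in>A. (c a + d a) * a)"
    by (simp add: sum.distrib algebra_simps)
  then show ?thesis unfolding semigroup_span_def by (intro CollectI exI[of _ "\<lambda>a. c a + d a"]) simp
qed

lemma semigroup_span_base:
  assumes "finite A" "a \<in> A"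
  shows "a \<in> semigroup_span A"
proof -
  have "a = (\<Sum>x\<in>A. (if x = a then 1 else 0) * x)"
    using assms by (simp add: if_distrib[of "\<lambda>c. c * _"] cong: if_cong)
  then show ?thesis unfolding semigroup_span_def by (intro CollectI exI) auto
qed

lemma semigroup_span_induct [consumes 2, case_names zero add]:
  assumes "finite A" and x: "x \<in> semigroup_span A"
    and "P 0" and add: "\<And>a y. a \<in> A \<Longrightarrow> P y \<Longrightarrow> P (a + y)"
  shows "P x"
proof -
  have mult: "P (k * a + y)" if "a \<in> A" "P y" for a y k
    using that by (induction k) (auto simp: add.assoc add)
  obtain c where c: "x = (\<Sum>a\<in>A. c a * a)"
    using x unfolding semigroup_span_def by blast
  have "P (\<Sum>a\<in>B. c a * a)" if "B \<subseteq> A" for B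
    using finite_subset[OF that \<open>finite A\<close>] that
    by (induction B rule: finite_induct) (auto simp: mult \<open>P 0\<close>)
  then show ?thesis using c by blast
qed

locale numerical_semigroup =
  fixes g :: "nat \<Rightarrow> nat" and n :: nat and S :: "nat set"
  assumes minimal: "minimal_generators g n"
    and S_eq: "S = semigroup_span (g ` {1..n})"
begin

abbreviation M :: "nat \<Rightarrow> nat set" where "M h \<equiv> hfold S h"

lemma n_pos: "1 \<in> {1..n}"
proof -
  have "Gcd (g ` {1..n}) = 1" using minimal unfolding minimal_generators_def by blast
  then have "n \<noteq> 0" by (intro notI) simp
  then show ?thesis by simp
qed

lemma g_pos: "j \<in> {1..n} \<Longrightarrow> 0 < g j"
  using minimal semigroup_span_zero unfolding minimal_generators_def by (metis gr0I)

lemma g1_pos: "0 < g 1"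
  using g_pos n_pos by blast

lemma g1_le: "j \<in> {1..n} \<Longrightarrow> g 1 \<le> g j"
  using minimal n_pos unfolding minimal_generators_def
  by (metis atLeastAtMost_iff strict_mono_on_leD)

lemma inj_g: "inj_on g {1..n}"
  using minimal strict_mono_on_imp_inj_on unfolding minimal_generators_def by blast

lemma S_zero: "0 \<in> S" and S_add: "x \<in> S \<Longrightarrow> y \<in> S \<Longrightarrow> x + y \<in> S"
  unfolding S_eq by (auto simp: semigroup_span_zero semigroup_span_add)

lemma S_mult: "x \<in> S \<Longrightarrow> k * x \<in> S"
  by (induction k) (auto simp: S_zero S_add)

lemma S_gen: "j \<in> {1..n} \<Longrightarrow> g j \<in> S"
  unfolding S_eq by (intro semigroup_span_base) auto

text \<open>Moves the coefficients from the values \<open>g j\<close> to the indices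
  \<open>j\<close>, where injectivity of \<open>g\<close> keeps the sums equal. Factorizations are
  handled in this indexed form from here on.\<close>

lemma S_iff: "s \<in> S \<longleftrightarrow> (\<exists>c. s = (\<Sum>j\<in>{1..n}. c j * g j))"
proof
  assume "s \<in> S"
  then obtain c where "s = (\<Sum>a\<in>g ` {1..n}. c a * a)"
    unfolding S_eq semigroup_span_def by blast
  then have "s = (\<Sum>j\<in>{1..n}. c (g j) * g j)"
    using inj_g by (simp add: sum.reindex)
  then show "\<exists>c. s = (\<Sum>j\<in>{1..n}. c j * g j)" by (intro exI[of _ "\<lambda>j. c (g j)"])
next
  assume "\<exists>c. s = (\<Sum>j\<in>{1..n}. c j * g j)"
  moreover have "(\<Sum>j\<in>J. c j * g j) \<in> S" if "J \<subseteq> {1..n}" for c J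
    using finite_subset[OF that finite_atLeastAtMost] that
    by (induction J rule: finite_induct) (auto simp: S_zero S_add S_mult S_gen)
  ultimately show "s \<in> S" by blast
qed

section \<open>The sets \<open>h M\<close> and lengths of factorizations\<close>

lemma M_zero [simp]: "M 0 = S"
  by (simp add: hfold_def)

lemma M_Suc: "M (Suc h) = {u + v | u v. u \<in> M h \<and> v \<in> S - {0}}"
proof (intro equalityI subsetI)
  fix s assume "s \<in> M (Suc h)"
  then obtain x where x: "s = (\<Sum>j<Suc h. x j)" "\<forall>j<Suc h. x j \<in> S - {0}"
    unfolding hfold_def by auto
  have "(\<Sum>j<h. x j) \<in> M h"
    using x(2) S_zero by (auto simp: hfold_def)
  with x show "s \<in> {u + v | u v. u \<in> M h \<and> v \<in> S - {0}}" by auto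
next
  fix s assume "s \<in> {u + v | u v. u \<in> M h \<and> v \<in> S - {0}}"
  then obtain u v where s: "s = u + v" and u: "u \<in> M h" and v: "v \<in> S - {0}" by blast
  \<comment> \<open>By convention \<open>M 0\<close> is all of \<open>S\<close> and not a set of
    sums, so a single summand has to be built separately.\<close>
  show "s \<in> M (Suc h)"
  proof (cases "h = 0")
    case True
    then have "s \<in> S - {0}" using s u v S_add by auto
    then show ?thesis using True unfolding hfold_def by (auto intro!: exI[of _ "\<lambda>_. s"])
  next
    case False
    then obtain x where "u = (\<Sum>j<h. x j)" "\<forall>j<h. x j \<in> S - {0}"
      using u unfolding hfold_def by auto
    then have "s = (\<Sum>j<Suc h. (x(h := v)) j)" "\<forall>j<Suc h. (x(h := v)) j \<in> S - {0}"
      using s v by auto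
    then show ?thesis unfolding hfold_def by (auto simp del: sum.lessThan_Suc)
  qed
qed

text \<open>Used to shorten a factorization by one copy of \<open>g j\<close>;
  \<open>0 < c j\<close> makes the natural subtraction exact.\<close>

lemma coeffs_Suc:
  assumes "j \<in> {1..n}" "0 < c j"
  shows "(\<Sum>i\<in>{1..n}. c i * g i) = (\<Sum>i\<in>{1..n}. (c(j := c j - 1)) i * g i) + g j"
    and "(\<Sum>i\<in>{1..n}. c i) = Suc (\<Sum>i\<in>{1..n}. (c(j := c j - 1)) i)"
proof -
  have split: "(\<Sum>i\<in>{1..n}. f i) = f j + (\<Sum>i\<in>{1..n}-{j}. f i)" for f :: "nat \<Rightarrow> nat"
    using assms by (intro sum.remove) auto
  have rest: "(\<Sum>i\<in>{1..n}-{j}. (c(j := c j - 1)) i * g i) = (\<Sum>i\<in>{1..n}-{j}. c i * g i)"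
    "(\<Sum>i\<in>{1..n}-{j}. (c(j := c j - 1)) i) = (\<Sum>i\<in>{1..n}-{j}. c i)"
    by (auto intro!: sum.cong)
  obtain k where "c j = Suc k" using assms(2) gr0_implies_Suc by blast
  then show "(\<Sum>i\<in>{1..n}. c i * g i) = (\<Sum>i\<in>{1..n}. (c(j := c j - 1)) i * g i) + g j"
    and "(\<Sum>i\<in>{1..n}. c i) = Suc (\<Sum>i\<in>{1..n}. (c(j := c j - 1)) i)"
    unfolding split rest by simp_all
qed

text \<open>Every summand from \<open>S - {0}\<close> has a factorization of positive length, and a
  nonempty factorization gives up one generator as last summand. The bound is an inequality because
  a summand may use several generators.\<close>

lemma M_iff: "s \<in> M h \<longleftrightarrow> (\<exists>c. s = (\<Sum>j\<in>{1..n}. c j * g j) \<and> h \<le> (\<Sum>j\<in>{1..n}. c j))"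
proof (induction h arbitrary: s)
  case 0
  then show ?case using S_iff by simp
next
  case (Suc h)
  show ?case
  proof
    assume "s \<in> M (Suc h)"
    then obtain u v where s: "s = u + v" "u \<in> M h" "v \<in> S - {0}" unfolding M_Suc by blast
    obtain c where c: "u = (\<Sum>j\<in>{1..n}. c j * g j)" "h \<le> (\<Sum>j\<in>{1..n}. c j)"
      using Suc s(2) by blast
    obtain d where d: "v = (\<Sum>j\<in>{1..n}. d j * g j)" using s(3) S_iff by blast
    have "(\<Sum>j\<in>{1..n}. d j) \<noteq> 0" using s(3) d by (intro notI) simp
    then have "Suc h \<le> (\<Sum>j\<in>{1..n}. c j + d j)"
      using c(2) unfolding sum.distrib by linarith
    moreover have "s = (\<Sum>j\<in>{1..n}. (c j + d j) * g j)"
      using c(1) d s(1) by (simp add: sum.distrib algebra_simps)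
    ultimately show "\<exists>c. s = (\<Sum>j\<in>{1..n}. c j * g j) \<and> Suc h \<le> (\<Sum>j\<in>{1..n}. c j)"
      by (intro exI[of _ "\<lambda>j. c j + d j"]) simp
  next
    assume "\<exists>c. s = (\<Sum>j\<in>{1..n}. c j * g j) \<and> Suc h \<le> (\<Sum>j\<in>{1..n}. c j)"
    then obtain c where c: "s = (\<Sum>j\<in>{1..n}. c j * g j)" "Suc h \<le> (\<Sum>j\<in>{1..n}. c j)" by blast
    then obtain j where j: "j \<in> {1..n}" "0 < c j"
      by (metis not_gr_zero not_less_eq_eq sum.neutral zero_le)
    have "(\<Sum>i\<in>{1..n}. (c(j := c j - 1)) i * g i) \<in> M h"
      using Suc c(2) coeffs_Suc(2)[of j c, OF j] by (metis Suc_le_mono)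
    moreover have "g j \<in> S - {0}" using S_gen g_pos j by fastforce
    ultimately show "s \<in> M (Suc h)"
      unfolding M_Suc c(1) using coeffs_Suc(1)[of j c, OF j] by blast
  qed
qed

lemma M_add: "u \<in> M h \<Longrightarrow> v \<in> M k \<Longrightarrow> u + v \<in> M (h + k)"
proof -
  assume "u \<in> M h" "v \<in> M k"
  then obtain c d where "u = (\<Sum>j\<in>{1..n}. c j * g j)" "h \<le> (\<Sum>j\<in>{1..n}. c j)"
    "v = (\<Sum>j\<in>{1..n}. d j * g j)" "k \<le> (\<Sum>j\<in>{1..n}. d j)"
    unfolding M_iff by blast
  then have "u + v = (\<Sum>j\<in>{1..n}. (c j + d j) * g j)" "h + k \<le> (\<Sum>j\<in>{1..n}. c j + d j)"
    by (auto simp: sum.distrib algebra_simps)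
  then show "u + v \<in> M (h + k)" unfolding M_iff by (intro exI[of _ "\<lambda>j. c j + d j"]) simp
qed

lemma M_mono: "h \<le> k \<Longrightarrow> M k \<subseteq> M h"
  unfolding subset_iff M_iff using le_trans by blast

lemma M_subset: "M h \<subseteq> S"
  using M_mono[of 0 h] by simp

lemma M_lower_bound: "s \<in> M h \<Longrightarrow> h * g 1 \<le> s"
proof -
  assume "s \<in> M h"
  then obtain c where c: "s = (\<Sum>j\<in>{1..n}. c j * g j)" "h \<le> (\<Sum>j\<in>{1..n}. c j)"
    unfolding M_iff by blast
  have "h * g 1 \<le> (\<Sum>j\<in>{1..n}. c j) * g 1" using c(2) by simp
  also have "\<dots> = (\<Sum>j\<in>{1..n}. c j * g 1)" by (rule sum_distrib_right)
  also have "\<dots> \<le> s" unfolding c(1) using g1_le by (intro sum_mono mult_le_mono) auto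
  finally show ?thesis .
qed

lemma M_le: "s \<in> M h \<Longrightarrow> h \<le> s"
proof -
  assume "s \<in> M h"
  from M_lower_bound[OF this] show "h \<le> s"
    using g1_pos by (metis One_nat_def Suc_leI le_trans mult.right_neutral mult_le_mono2)
qed

text \<open>Sharper than \<open>M_Suc\<close>: the summand split off is a generator, which makes the
  sums in \<open>filt_Suc_decomp\<close> finite.\<close>

lemma M_SucE:
  assumes "s \<in> M (Suc h)"
  obtains j s' where "j \<in> {1..n}" "s' \<in> M h" "s = s' + g j"
proof -
  obtain c where c: "s = (\<Sum>j\<in>{1..n}. c j * g j)" "Suc h \<le> (\<Sum>j\<in>{1..n}. c j)"
    using assms unfolding M_iff by blast
  then obtain j where j: "j \<in> {1..n}" "0 < c j"
    by (metis not_gr_zero not_less_eq_eq sum.neutral zero_le)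
  have "(\<Sum>i\<in>{1..n}. (c(j := c j - 1)) i * g i) \<in> M h"
    using M_iff c(2) coeffs_Suc(2)[of j c, OF j] by (metis Suc_le_mono)
  then show thesis using that j(1) c(1) coeffs_Suc(1)[of j c, OF j] by blast
qed

lemma M_gen: "j \<in> {1..n} \<Longrightarrow> g j \<in> M (Suc 0)"
  unfolding M_Suc using S_zero S_gen g_pos by force

lemma M_add_g1: "s \<in> M h \<Longrightarrow> s + k * g 1 \<in> M (h + k)"
proof (induction k)
  case (Suc k)
  then show ?case using M_add[OF _ M_gen[OF n_pos], of "s + k * g 1" "h + k"] by (simp add: algebra_simps)
qed simp

section \<open>The order of an element\<close>

text \<open>The degree used in \<open>monomial_class\<close>; by \<open>M_iff\<close> it is, for
  \<open>s\<close> in \<open>S\<close>, the greatest length of a factorization of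
  \<open>s\<close>.\<close>

definition ord :: "nat \<Rightarrow> nat" where
  "ord s = (THE h. s \<in> M h \<and> s \<notin> M (h + 1))"

text \<open>The sets \<open>M h\<close> decrease, and \<open>M_le\<close> bounds the
  \<open>h\<close> with \<open>s \<in> M h\<close>, so these \<open>h\<close> are exactly those up
  to a maximum.\<close>

lemma M_iff_le_ord:
  assumes "s \<in> S"
  shows "s \<in> M h \<longleftrightarrow> h \<le> ord s"
proof -
  define H where "H = {h. s \<in> M h}"
  have fin: "finite H" by (rule finite_subset[of _ "{..s}"]) (use M_le H_def in blast, simp)
  have ne: "H \<noteq> {}" using assms M_zero unfolding H_def by blast
  have *: "s \<in> M h \<longleftrightarrow> h \<le> Max H" for h
  proof
    show "s \<in> M h \<Longrightarrow> h \<le> Max H" using Max_ge[OF fin] unfolding H_def by blast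
    show "h \<le> Max H \<Longrightarrow> s \<in> M h" using Max_in[OF fin ne] M_mono unfolding H_def by blast
  qed
  have "ord s = Max H" unfolding ord_def
    unfolding * by (rule the_equality) auto
  then show ?thesis using * by simp
qed

lemma ord_M: "s \<in> S \<Longrightarrow> s \<in> M (ord s)"
  by (simp add: M_iff_le_ord)

lemma ord_ge: "s \<in> M h \<Longrightarrow> h \<le> ord s"
  using M_iff_le_ord M_subset by blast

lemma ord_add: "u \<in> S \<Longrightarrow> v \<in> S \<Longrightarrow> ord u + ord v \<le> ord (u + v)"
  by (intro ord_ge M_add ord_M)

text \<open>As \<open>g 1\<close> is the least generator, no factorization of \<open>k * g 1\<close>
  has more than \<open>k\<close> terms.\<close>

lemma ord_g1_mult: "ord (k * g 1) = k"
proof (rule antisym)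
  show "k \<le> ord (k * g 1)" using ord_ge[OF M_add_g1[of 0 0 k]] S_zero by simp
  have "k * g 1 \<in> S" using S_mult S_gen n_pos by blast
  then show "ord (k * g 1) \<le> k" using M_lower_bound[OF ord_M] g1_pos by force
qed

lemma S_add_g1: "s \<in> S \<Longrightarrow> s + k * g 1 \<in> S"
  using S_add S_mult S_gen n_pos by blast

lemma ord_add_g1: "s \<in> S \<Longrightarrow> ord s + k \<le> ord (s + k * g 1)"
  using M_add_g1 ord_M ord_ge by blast

section \<open>Residues modulo \<open>g 1\<close> and the reduction property\<close>

lemma S_residue: "\<exists>s\<in>S. s mod g 1 = i mod g 1"
proof -
  \<comment> \<open>\<open>D\<close> is the non-negative part of the group generated by
    \<open>S\<close> in the integers. Its least positive element divides all generators, hence their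
    gcd, so it is \<open>1\<close>.\<close>
  define D where "D = {d. \<exists>s\<in>S. \<exists>t\<in>S. s = t + d}"
  have "g 1 \<in> D" unfolding D_def using S_gen[OF n_pos] S_zero by force
  then have ex: "\<exists>d. d \<in> D \<and> 0 < d" using g1_pos by blast
  define d where "d = (LEAST d. d \<in> D \<and> 0 < d)"
  have d: "d \<in> D" "0 < d" using LeastI_ex[OF ex] unfolding d_def by blast+
  have least: "d \<le> x" if "x \<in> D" "0 < x" for x
    unfolding d_def using that by (intro Least_le) blast
  obtain s t where st: "s \<in> S" "t \<in> S" "s = t + d" using d D_def by blast
  have "d dvd x" if x: "x \<in> S" for x
  proof -
    \<comment> \<open>Since \<open>s = t + d\<close>, division with remainder exhibits
      \<open>x mod d\<close> as a difference of elements of \<open>S\<close>.\<close>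
    have "x + (x div d) * t = (x div d) * s + x mod d"
      using st(3) by (simp add: algebra_simps)
    then have "x mod d \<in> D" unfolding D_def using x st S_mult S_add by blast
    then show ?thesis using least d(2) by (metis mod_greater_zero_iff_not_dvd mod_less_divisor not_le)
  qed
  then have "d dvd Gcd (g ` {1..n})" using S_gen by (intro Gcd_greatest) auto
  then have "d = 1" using minimal unfolding minimal_generators_def by simp
  \<comment> \<open>With \<open>s = t + 1\<close>, the difference \<open>i * s - i * t\<close> is
    \<open>i\<close>. Modulo \<open>g 1\<close>, subtracting \<open>i * t\<close> amounts to adding
    \<open>i * e * t\<close>, as \<open>e = g 1 - 1\<close>.\<close>
  obtain e where e: "g 1 = Suc e" using g1_pos gr0_implies_Suc by blast
  have "i * s + (i * e) * t = i + (i * t) * g 1"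
    using st(3) \<open>d = 1\<close> e by (simp add: algebra_simps)
  moreover have "i * s + (i * e) * t \<in> S" using st S_mult S_add by blast
  ultimately show ?thesis by (metis mod_mult_self1)
qed

text \<open>By pigeonhole a factorization with more than \<open>n * g 1\<close> terms uses some
  generator more than \<open>g 1\<close> times, which allows an exchange that brings in
  \<open>g 1\<close> without shortening the factorization.\<close>

lemma M_reduction: "\<exists>r. \<forall>s \<in> M (Suc r). \<exists>s' \<in> M r. s = s' + g 1"
proof (intro exI ballI)
  let ?r = "n * g 1"
  fix s assume "s \<in> M (Suc ?r)"
  then obtain c where c: "s = (\<Sum>j\<in>{1..n}. c j * g j)" "Suc ?r \<le> (\<Sum>j\<in>{1..n}. c j)"
    unfolding M_iff by blast
  have "\<exists>c'. s = (\<Sum>j\<in>{1..n}. c' j * g j) \<and> Suc ?r \<le> (\<Sum>j\<in>{1..n}. c' j) \<and> 0 < c' 1"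
  proof (cases "0 < c 1")
    case True
    then show ?thesis using c by blast
  next
    case False
    obtain j where j: "j \<in> {1..n}" "g 1 < c j"
    proof (rule ccontr)
      assume "\<not> thesis"
      then have "(\<Sum>j\<in>{1..n}. c j) \<le> (\<Sum>j\<in>{1..n}. g 1)"
        using that by (intro sum_mono) (metis not_less)
      then show False using c(2) by simp
    qed
    with False have j1: "j \<noteq> 1" by auto
    text \<open>Trade \<open>g 1\<close> copies of \<open>g j\<close> for the at least as many \<open>g j\<close> copies of \<open>g 1\<close>.\<close>
    define c' where "c' = c(j := c j - g 1, 1 := g j)"
    have split: "(\<Sum>i\<in>{1..n}. f i) = f 1 + (f j + (\<Sum>i\<in>{1..n}-{1}-{j}. f i))" for f :: "nat \<Rightarrow> nat"
    proof -
      have "(\<Sum>i\<in>{1..n}-{1}. f i) = f j + (\<Sum>i\<in>{1..n}-{1}-{j}. f i)"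
        using j j1 by (intro sum.remove) auto
      with sum.remove[OF finite_atLeastAtMost n_pos, of f] show ?thesis by (rule trans[OF _ arg_cong])
    qed
    have rest: "(\<Sum>i\<in>{1..n}-{1}-{j}. c' i * g i) = (\<Sum>i\<in>{1..n}-{1}-{j}. c i * g i)"
      "(\<Sum>i\<in>{1..n}-{1}-{j}. c' i) = (\<Sum>i\<in>{1..n}-{1}-{j}. c i)"
      by (auto simp: c'_def intro!: sum.cong)
    have "c j * g j = g 1 * g j + (c j - g 1) * g j"
      using j(2) by (metis add_mult_distrib le_add_diff_inverse less_imp_le_nat)
    then have "s = (\<Sum>j\<in>{1..n}. c' j * g j)"
      unfolding c(1) split rest using False j1 by (simp add: c'_def)
    moreover have "Suc ?r \<le> (\<Sum>j\<in>{1..n}. c' j)"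
    proof -
      have "c' 1 = g j" "c' j = c j - g 1" using j1 by (simp_all add: c'_def)
      then show ?thesis
        using c(2) False j(2) g1_le[OF j(1)] unfolding split rest by linarith
    qed
    moreover have "0 < c' 1" using j g_pos by (simp add: c'_def)
    ultimately show ?thesis by blast
  qed
  then obtain c' where c': "s = (\<Sum>j\<in>{1..n}. c' j * g j)" "Suc ?r \<le> (\<Sum>j\<in>{1..n}. c' j)" "0 < c' 1"
    by blast
  have "(\<Sum>i\<in>{1..n}. (c'(1 := c' 1 - 1)) i * g i) \<in> M ?r"
    using M_iff c'(2) coeffs_Suc(2)[of 1 c', OF n_pos c'(3)] by (metis Suc_le_mono)
  then show "\<exists>s' \<in> M ?r. s = s' + g 1"
    using c'(1) coeffs_Suc(1)[of 1 c', OF n_pos c'(3)] by blast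
qed

text \<open>The exponents \<open>s\<close> for which the class of \<open>t\<^sup>s\<close> is killed by a power of the class of
  \<open>t\<close> to the \<open>g 1\<close>.\<close>

definition torsion :: "nat \<Rightarrow> bool" where
  "torsion s \<longleftrightarrow> (\<exists>N. ord s + N < ord (s + N * g 1))"

section \<open>Torsion exponents under addition\<close>

text \<open>Adding \<open>k * g 1\<close> raises the order by at least \<open>k\<close>, so an
  excess found after \<open>N\<close> further steps is an excess over \<open>s\<close> after
  \<open>k + N\<close> steps.\<close>

lemma torsion_antimono:
  assumes "s \<in> S" "torsion (s + k * g 1)"
  shows "torsion s"
proof -
  obtain N where "ord (s + k * g 1) + N < ord (s + k * g 1 + N * g 1)"
    using assms unfolding torsion_def by blast
  with ord_add_g1[OF assms(1), of k] have "ord s + (k + N) < ord (s + (k + N) * g 1)"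
    by (simp add: algebra_simps)
  then show ?thesis unfolding torsion_def by blast
qed

text \<open>In \<open>step\<close> a generator is split off \<open>s + g 1\<close>. The remainder
  still lies in \<open>M (Suc r)\<close>, so it contains a copy of \<open>g 1\<close>; the induction
  hypothesis cancels that copy, and the generator is put back.\<close>

lemma M_cancel_g1:
  assumes r: "\<forall>s \<in> M (Suc r). \<exists>s' \<in> M r. s = s' + g 1"
    and "r \<le> h" "s + N * g 1 \<in> M (h + N)"
  shows "s \<in> M h"
proof -
  have step: "s \<in> M (r + d)" if "s + g 1 \<in> M (Suc (r + d))" for s d
    using that
  proof (induction d arbitrary: s)
    case 0
    then show ?case using r by auto
  next
    case (Suc d)
    then obtain j u where j: "j \<in> {1..n}" "u \<in> M (Suc (r + d))" "s + g 1 = u + g j"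
      by (metis M_SucE add_Suc_right)
    obtain u' where u': "u' \<in> M (r + d)" "u = u' + g 1"
    proof -
      have "u \<in> M (Suc r)" using j(2) M_mono by (meson Suc_le_mono le_add1 subsetD)
      then obtain u' where "u = u' + g 1" using r by blast
      then show thesis using Suc.IH that j(2) by blast
    qed
    then have "s = u' + g j" using j(3) by simp
    then show ?case using M_add[OF u'(1) M_gen[OF j(1)]] by simp
  qed
  have "s + N * g 1 \<in> M (h + N) \<Longrightarrow> s \<in> M h" for s
  proof (induction N arbitrary: s)
    case (Suc N)
    have "(s + N * g 1) + g 1 \<in> M (Suc (r + (h + N - r)))"
      using Suc.prems \<open>r \<le> h\<close> by (simp add: algebra_simps)
    from step[OF this] show ?case using Suc.IH \<open>r \<le> h\<close> by simp
  qed simp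
  then show ?thesis using assms(3) by blast
qed

text \<open>The excess of \<open>u\<close> after \<open>N\<close> steps passes to
  \<open>u + v\<close>, and then the \<open>N\<close> copies of \<open>g 1\<close> are cancelled.
  Cancellation happens in degree \<open>Suc (ord u + ord v)\<close>, whence the bound on
  \<open>r\<close>.\<close>

lemma torsion_ord_add:
  assumes r: "\<forall>s \<in> M (Suc r). \<exists>s' \<in> M r. s = s' + g 1"
    and "u \<in> S" "v \<in> S" "torsion u" "r \<le> Suc (ord u + ord v)"
  shows "ord u + ord v < ord (u + v)"
proof -
  obtain N where "ord u + N < ord (u + N * g 1)" using assms unfolding torsion_def by blast
  then have "u + N * g 1 \<in> M (Suc (ord u + N))"
    using M_iff_le_ord[OF S_add_g1[OF \<open>u \<in> S\<close>]] by simp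
  from M_add[OF this ord_M[OF \<open>v \<in> S\<close>]]
  have "(u + v) + N * g 1 \<in> M (Suc (ord u + ord v) + N)" by (simp add: algebra_simps)
  from M_cancel_g1[OF r assms(5) this] show ?thesis using ord_ge by fastforce
qed

text \<open>At order \<open>r\<close> or more, \<open>torsion_ord_add\<close> with
  \<open>v = 0\<close> would make \<open>ord s\<close> exceed itself.\<close>

lemma torsion_ord_less:
  assumes r: "\<forall>s \<in> M (Suc r). \<exists>s' \<in> M r. s = s' + g 1"
    and "s \<in> S" "torsion s"
  shows "ord s < r"
proof (rule ccontr)
  assume "\<not> ord s < r"
  then have "ord s + ord 0 < ord (s + 0)"
    using assms S_zero by (intro torsion_ord_add[OF r]) auto
  then show False by simp
qed

text \<open>The torsion values of \<open>k\<close> are closed downwards by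
  \<open>torsion_antimono\<close>, and bounded since the order of \<open>s + k * g 1\<close> is at
  least \<open>k\<close> but below \<open>r\<close>. So \<open>GREATEST\<close> is a true
  maximum.\<close>

lemma torsion_greatest:
  assumes r: "\<forall>s \<in> M (Suc r). \<exists>s' \<in> M r. s = s' + g 1"
    and "s \<in> S" "torsion s"
  defines "l \<equiv> GREATEST k. torsion (s + k * g 1)"
  shows "torsion (s + k * g 1) \<longleftrightarrow> k \<le> l"
proof -
  have bound: "k \<le> r" if "torsion (s + k * g 1)" for k
    using torsion_ord_less[OF r S_add_g1[OF \<open>s \<in> S\<close>] that] ord_add_g1[OF \<open>s \<in> S\<close>, of k] by simp
  have "torsion (s + l * g 1)"
    unfolding l_def by (rule GreatestI_nat[of _ 0 r]) (use assms bound in auto)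
  then have "torsion (s + k * g 1)" if "k \<le> l"
    using torsion_antimono[OF S_add_g1[OF \<open>s \<in> S\<close>], of k "l - k"] that
    by (metis add.assoc add_mult_distrib le_add_diff_inverse)
  moreover have "k \<le> l" if "torsion (s + k * g 1)"
    unfolding l_def by (rule Greatest_le_nat[of _ k r]) (use that bound in auto)
  ultimately show ?thesis by blast
qed

section \<open>Apery elements and the blow-up semigroup\<close>

lemma apery_props:
  "apery S (g 1) i \<in> S" "apery S (g 1) i mod g 1 = i mod g 1"
  using LeastI_ex[of "\<lambda>s. s \<in> S \<and> s mod g 1 = i mod g 1"] S_residue
  unfolding apery_def by blast+

lemma S_apery_decomp:
  assumes "s \<in> S"
  obtains k where "s = apery S (g 1) (s mod g 1) + k * g 1"
proof -
  have "apery S (g 1) (s mod g 1) \<le> s"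
    unfolding apery_def using assms by (intro Least_le) auto
  moreover have "apery S (g 1) (s mod g 1) mod g 1 = s mod g 1"
    using apery_props(2) by simp
  ultimately show thesis using that
    by (metis mod_eq_dvd_iff_nat dvd_def le_add_diff_inverse mult.commute)
qed

text \<open>The set \<open>S'\<close> of the theorem: the exponents of the blow-up of the ring at
  its maximal ideal, where \<open>t^(g j)\<close> is divided by \<open>t^(g 1)\<close>.\<close>

definition blowup :: "nat set" where
  "blowup = semigroup_span (insert (g 1) ((\<lambda>i. g i - g 1) ` {2..n}))"

lemma blowup_zero: "0 \<in> blowup" and blowup_add: "x \<in> blowup \<Longrightarrow> y \<in> blowup \<Longrightarrow> x + y \<in> blowup"
  unfolding blowup_def by (auto simp: semigroup_span_zero semigroup_span_add)

lemma blowup_g1: "g 1 \<in> blowup"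
  unfolding blowup_def by (intro semigroup_span_base) auto

lemma blowup_diff: "j \<in> {1..n} \<Longrightarrow> g j - g 1 \<in> blowup"
proof (cases "j = 1")
  case False
  assume "j \<in> {1..n}"
  with False have "j \<in> {2..n}" by auto
  then show ?thesis unfolding blowup_def by (intro semigroup_span_base) auto
qed (simp add: blowup_zero)

text \<open>\<open>N\<close> counts the generators \<open>g j - g 1\<close> in a representation of
  \<open>x\<close>: each needs one copy of \<open>g 1\<close> to become \<open>g j\<close>, while
  \<open>g 1\<close> itself needs none.\<close>

lemma blowup_lift:
  assumes "x \<in> blowup"
  shows "\<exists>N. x + N * g 1 \<in> M N"
proof -
  have "finite (insert (g 1) ((\<lambda>i. g i - g 1) ` {2..n}))" by simp
  from this assms[unfolded blowup_def] show ?thesis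
  proof (induction rule: semigroup_span_induct)
    case zero
    show ?case using S_zero by (intro exI[of _ 0]) simp
  next
    case (add a y)
    then obtain N where N: "y + N * g 1 \<in> M N" by blast
    from add(1) consider "a = g 1" | j where "j \<in> {2..n}" "a = g j - g 1" by blast
    then show ?case
    proof cases
      case 1
      have "y + N * g 1 + g 1 \<in> M N"
        using M_add_g1[OF N, of 1] M_mono[of N "N + 1"] by auto
      then show ?thesis unfolding 1 by (intro exI[of _ N]) (simp add: algebra_simps)
    next
      case 2
      then have "j \<in> {1..n}" by auto
      with M_add[OF N M_gen[OF this]] 2 g1_le[OF this] show ?thesis
        by (intro exI[of _ "Suc N"]) (simp add: algebra_simps)
    qed
  qed
qed

lemma S_subset_blowup: "S \<subseteq> blowup"
proof
  fix s assume "s \<in> S"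
  have "finite (g ` {1..n})" by simp
  from this \<open>s \<in> S\<close>[unfolded S_eq] show "s \<in> blowup"
  proof (induction rule: semigroup_span_induct)
    case (add a y)
    then obtain j where j: "j \<in> {1..n}" "a = g j" by blast
    then have "a = g 1 + (g j - g 1)" using g1_le by simp
    then show ?case using blowup_add blowup_g1 blowup_diff j add by metis
  qed (simp_all add: blowup_zero)
qed

text \<open>Each of the \<open>h\<close> generators split off is \<open>g 1\<close> plus an element
  of \<open>blowup\<close>, and the remaining element of \<open>S\<close> lies in
  \<open>blowup\<close>.\<close>

lemma M_blowup:
  assumes "s \<in> M h"
  obtains x where "x \<in> blowup" "s = h * g 1 + x"
proof -
  have "\<exists>x\<in>blowup. s = h * g 1 + x" using assms
  proof (induction h arbitrary: s)
    case 0
    then show ?case using S_subset_blowup by auto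
  next
    case (Suc h)
    obtain j s' where j: "j \<in> {1..n}" "s' \<in> M h" "s = s' + g j" using M_SucE Suc.prems by blast
    obtain x where x: "x \<in> blowup" "s' = h * g 1 + x" using Suc.IH j by blast
    have "s = Suc h * g 1 + (x + (g j - g 1))" using x j(3) g1_le[OF j(1)] by simp
    then show ?case using x blowup_add blowup_diff j by blast
  qed
  then show thesis using that by blast
qed

text \<open>Let \<open>w\<close> and \<open>w'\<close> be the two Apery elements. If
  \<open>a\<close> exceeds \<open>ord w\<close>, a lift of \<open>w'\<close> into \<open>M N\<close>
  puts \<open>w + N * g 1\<close> into \<open>M (N + a)\<close>, an excess. Conversely an excess
  gives \<open>w = Suc (ord w) * g 1 + x\<close> with \<open>x\<close> in \<open>blowup\<close>, and
  minimality of \<open>w'\<close> yields \<open>w' \<le> x\<close>.\<close>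

lemma apery_torsion_iff:
  fixes a :: int
  assumes a: "int (apery blowup (g 1) i) + a * int (g 1) = int (apery S (g 1) i)"
  shows "int (ord (apery S (g 1) i)) < a \<longleftrightarrow> torsion (apery S (g 1) i)"
proof -
  define w where "w = apery S (g 1) i"
  define w' where "w' = apery blowup (g 1) i"
  have w: "w \<in> S" "w mod g 1 = i mod g 1" unfolding w_def by (rule apery_props)+
  have w': "w' \<in> blowup"
    using LeastI[of "\<lambda>s. s \<in> blowup \<and> s mod g 1 = i mod g 1" w] S_subset_blowup w
    unfolding w'_def apery_def by blast
  have a: "int w' + a * int (g 1) = int w" using a by (simp add: w_def w'_def)
  have "int (ord w) < a \<longleftrightarrow> torsion w"
  proof
    assume *: "int (ord w) < a"
    then obtain k where k: "a = int k" by (metis le_less_trans of_nat_0_le_iff zero_le_imp_eq_int less_imp_le)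
    obtain N where N: "w' + N * g 1 \<in> M N" using blowup_lift w' by blast
    have "w = w' + k * g 1" using a unfolding k by (metis of_nat_add of_nat_eq_iff of_nat_mult)
    with M_add_g1[OF N, of k] have "w + N * g 1 \<in> M (N + k)" by (simp add: algebra_simps)
    from ord_ge[OF this] * k show "torsion w" unfolding torsion_def by (intro exI[of _ N]) simp
  next
    assume "torsion w"
    then obtain N where "ord w + N < ord (w + N * g 1)" unfolding torsion_def by blast
    then have "w + N * g 1 \<in> M (Suc (ord w) + N)"
      using M_iff_le_ord[OF S_add_g1[OF w(1)]] by simp
    then obtain x where x: "x \<in> blowup" "w + N * g 1 = (Suc (ord w) + N) * g 1 + x"
      using M_blowup by blast
    then have wx: "w = Suc (ord w) * g 1 + x" by (simp add: algebra_simps)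
    then have "x mod g 1 = i mod g 1" using w(2) by (metis add.commute mod_mult_self1)
    then have "w' \<le> x" unfolding w'_def apery_def using x(1) by (intro Least_le) auto
    then have "int (Suc (ord w)) * int (g 1) \<le> a * int (g 1)"
      using a wx by (metis add.commute add_le_imp_le_left add_mono_thms_linordered_semiring(1)
          of_nat_add of_nat_mono of_nat_mult order_refl)
    then show "int (ord w) < a" using g1_pos by simp
  qed
  then show ?thesis by (simp add: w_def)
qed

lemma Greatest_M: "s \<in> S \<Longrightarrow> (GREATEST h. s \<in> M h) = ord s"
  by (intro Greatest_equality) (auto simp: M_iff_le_ord)

end


subsection \<open>The filtration by powers of the maximal ideal\<close>

text \<open>These rules would unfold the powers of the maximal ideal before they are recognized.\<close>

declare nat_pow_0 [simp del] nat_pow_Suc [simp del]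

lemma ideal_pow_zero: "ideal_pow A I 0 = carrier A"
  and ideal_pow_Suc: "ideal_pow A I (Suc k) = ideal_prod A (ideal_pow A I k) I"
  by (simp_all add: nat_pow_def ideals_set_def)

context numerical_semigroup
begin

abbreviation R :: "'k::field fps ring" where "R \<equiv> semigroup_ring S"

text \<open>The candidate for the \<open>h\<close>-th power of the maximal ideal, read off from
  supports; \<open>ideal_pow_mideal\<close> confirms it.\<close>

definition filt :: "nat \<Rightarrow> 'k::field fps set" where
  "filt h = {f. \<forall>s. fps_nth f s \<noteq> 0 \<longrightarrow> s \<in> M h}"

lemma R_simps [simp]:
  "carrier R = filt 0" "x \<otimes>\<^bsub>R\<^esub> y = x * y" "x \<oplus>\<^bsub>R\<^esub> y = x + y" "\<zero>\<^bsub>R\<^esub> = 0" "\<one>\<^bsub>R\<^esub> = 1"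
  by (simp_all add: semigroup_ring_def ring_of_type_algebra_def filt_def)

lemma filt_zero: "0 \<in> filt h"
  by (simp add: filt_def)

lemma filt_add: "x \<in> filt h \<Longrightarrow> y \<in> filt h \<Longrightarrow> x + y \<in> filt h"
  unfolding filt_def mem_Collect_eq fps_add_nth by (metis add_0)

lemma filt_uminus: "x \<in> filt h \<Longrightarrow> - x \<in> filt h"
  by (simp add: filt_def)

lemma filt_sum: "(\<And>i. i \<in> I \<Longrightarrow> x i \<in> filt h) \<Longrightarrow> (\<Sum>i\<in>I. x i) \<in> filt h"
  by (induction I rule: infinite_finite_induct) (auto simp: filt_zero filt_add)

lemma filt_mult:
  assumes "x \<in> filt h" "y \<in> filt k"
  shows "x * y \<in> filt (h + k)"
  unfolding filt_def
proof (intro CollectI allI impI)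
  fix s assume "(x * y) $ s \<noteq> 0"
  then obtain i where i: "i \<le> s" "x $ i \<noteq> 0" "y $ (s - i) \<noteq> 0"
    unfolding fps_mult_nth by (elim sum.not_neutral_contains_not_neutral) auto
  then have "i + (s - i) \<in> M (h + k)"
    using assms unfolding filt_def by (intro M_add) auto
  then show "s \<in> M (h + k)" using i by simp
qed

lemma filt_mono: "h \<le> k \<Longrightarrow> filt k \<subseteq> filt h"
  unfolding filt_def using M_mono by blast

lemma filt_monomial: "s \<in> M h \<Longrightarrow> fps_X ^ s \<in> filt h"
  by (simp add: filt_def fps_X_power_nth)

lemma cring_R: "cring (R :: 'k::field fps ring)"
proof -
  interpret full: cring "ring_of_type_algebra :: 'k fps ring" by (rule cring_from_type_algebra)
  have "subring (filt 0) (ring_of_type_algebra :: 'k fps ring)"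
  proof (rule full.subringI)
    fix x :: "'k fps" assume "x \<in> filt 0"
    moreover have "\<ominus>\<^bsub>ring_of_type_algebra\<^esub> x = - x"
      by (rule full.minus_equality) (simp_all add: ring_of_type_algebra_def)
    ultimately show "\<ominus>\<^bsub>ring_of_type_algebra\<^esub> x \<in> filt 0" by (simp add: filt_uminus)
  next
    show "\<one>\<^bsub>ring_of_type_algebra\<^esub> \<in> filt 0"
      using filt_monomial[of 0 0] S_zero by (simp add: ring_of_type_algebra_def)
  next
    fix x y :: "'k fps" assume xy: "x \<in> filt 0" "y \<in> filt 0"
    show "x \<oplus>\<^bsub>ring_of_type_algebra\<^esub> y \<in> filt 0" "x \<otimes>\<^bsub>ring_of_type_algebra\<^esub> y \<in> filt 0"
      using filt_add[OF xy] filt_mult[OF xy] by (simp_all add: ring_of_type_algebra_def)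
  qed (simp add: ring_of_type_algebra_def)
  then have "subcring (filt 0) (ring_of_type_algebra :: 'k fps ring)"
    by (rule full.subcringI')
  then have "cring (ring_of_type_algebra\<lparr>carrier := filt 0\<rparr> :: 'k fps ring)"
    using full.subcring_iff[of "filt 0"] by (simp add: ring_of_type_algebra_def)
  then show ?thesis by (simp add: semigroup_ring_def filt_def)
qed

text \<open>Each exponent in \<open>M (Suc h)\<close> is assigned one generator that can be split
  off. With only \<open>n\<close> generators, even a series of infinite support becomes a finite sum
  of products.\<close>

lemma filt_Suc_decomp:
  assumes "f \<in> filt (Suc h)"
  obtains F where "\<And>j. j \<in> {1..n} \<Longrightarrow> F j \<in> filt h" "f = (\<Sum>j\<in>{1..n}. F j * fps_X ^ g j)"
proof -
  have "\<forall>s\<in>M (Suc h). \<exists>j\<in>{1..n}. \<exists>s'\<in>M h. s = s' + g j" using M_SucE by metis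
  then obtain J where J: "\<And>s. s \<in> M (Suc h) \<Longrightarrow> J s \<in> {1..n} \<and> (\<exists>s'\<in>M h. s = s' + g (J s))"
    by metis
  \<comment> \<open>\<open>F j\<close> collects the terms of \<open>f\<close> assigned to
    \<open>j\<close>, divided by \<open>fps_X ^ g j\<close>.\<close>
  define F where "F j = Abs_fps (\<lambda>u.
    if u + g j \<in> M (Suc h) \<and> J (u + g j) = j then f $ (u + g j) else 0)" for j
  have nth: "(F j * fps_X ^ g j) $ s = (if s \<in> M (Suc h) \<and> J s = j then f $ s else 0)" for j s
    using J[of s] by (auto simp: fps_X_power_mult_right_nth F_def)
  show thesis
  proof
    show "F j \<in> filt h" for j
      using J unfolding filt_def F_def by (auto split: if_splits) (metis add_right_cancel)
    show "f = (\<Sum>j\<in>{1..n}. F j * fps_X ^ g j)"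
    proof (rule fps_ext)
      fix s
      show "f $ s = (\<Sum>j\<in>{1..n}. F j * fps_X ^ g j) $ s"
      proof (cases "s \<in> M (Suc h)")
        case True
        then show ?thesis unfolding fps_sum_nth nth using J[OF True] by simp
      next
        case False
        then show ?thesis using assms unfolding fps_sum_nth nth filt_def by auto
      qed
    qed
  qed
qed

section \<open>The maximal ideal, its powers and its reduction number\<close>

definition mideal :: "'k::field fps set" where
  "mideal = Idl\<^bsub>R\<^esub> ((\<lambda>i. fps_X ^ g i) ` {1..n})"

lemma ideal_filt: "ideal (filt h) (R :: 'k::field fps ring)"
proof -
  interpret cring "R :: 'k fps ring" by (rule cring_R)
  show ?thesis
  proof (rule idealI)
    show "subgroup (filt h) (add_monoid (R :: 'k fps ring))"
    proof (rule add.subgroupI)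
      fix x :: "'k fps" assume x: "x \<in> filt h"
      then have "x \<in> filt 0" using filt_mono[of 0 h] by auto
      then have "\<ominus>\<^bsub>R\<^esub> x = - x" using filt_uminus[of x 0] by (intro minus_equality) simp_all
      then show "\<ominus>\<^bsub>R\<^esub> x \<in> filt h"
        using filt_uminus[OF x] by simp
    qed (use filt_mono[of 0 h] filt_zero[of h] filt_add in auto)
  next
    fix a x :: "'k fps" assume "a \<in> filt h" "x \<in> carrier R"
    then show "x \<otimes>\<^bsub>R\<^esub> a \<in> filt h" "a \<otimes>\<^bsub>R\<^esub> x \<in> filt h"
      using filt_mult[of x 0 a h] filt_mult[of a h x 0] by simp_all
  qed (rule local.ring_axioms)
qed

lemma mideal_eq: "(mideal :: 'k::field fps set) = filt (Suc 0)"
proof -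
  interpret cring "R :: 'k fps ring" by (rule cring_R)
  let ?gens = "(\<lambda>i. fps_X ^ g i) ` {1..n} :: 'k fps set"
  have gens: "?gens \<subseteq> filt (Suc 0)"
    using filt_monomial M_gen by blast
  have sub: "?gens \<subseteq> carrier R" using gens filt_mono[of 0 "Suc 0"] by auto
  interpret I: ideal "Idl\<^bsub>R\<^esub> ?gens" "R :: 'k fps ring" by (rule genideal_ideal[OF sub])
  have "f \<in> Idl\<^bsub>R\<^esub> ?gens" if "f \<in> filt (Suc 0)" for f
  proof -
    obtain F where F: "\<And>j. j \<in> {1..n} \<Longrightarrow> F j \<in> filt 0" "f = (\<Sum>j\<in>{1..n}. F j * fps_X ^ g j)"
      using filt_Suc_decomp \<open>f \<in> filt (Suc 0)\<close> by blast
    have "(\<Sum>j\<in>J. F j * fps_X ^ g j) \<in> Idl\<^bsub>R\<^esub> ?gens" if "J \<subseteq> {1..n}" for J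
      using finite_subset[OF that finite_atLeastAtMost] that
    proof (induction J rule: finite_induct)
      case empty
      then show ?case using I.zero_closed by simp
    next
      case (insert j J)
      then have "fps_X ^ g j \<in> Idl\<^bsub>R\<^esub> ?gens" using genideal_self[OF sub] by auto
      then have "F j \<otimes>\<^bsub>R\<^esub> fps_X ^ g j \<in> Idl\<^bsub>R\<^esub> ?gens"
        using F(1)[of j] insert.prems by (intro I.I_l_closed) auto
      then show ?case using insert I.a_closed by fastforce
    qed
    then show ?thesis using F(2) by blast
  qed
  moreover have "Idl\<^bsub>R\<^esub> ?gens \<subseteq> filt (Suc 0)"
    using genideal_minimal[OF ideal_filt gens] .
  ultimately show ?thesis unfolding mideal_def by blast
qed

text \<open>Products lie deep enough by \<open>filt_mult\<close>; for the converse,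
  \<open>filt_Suc_decomp\<close> gives a finite sum of products with monomials from the maximal
  ideal.\<close>

lemma ideal_pow_mideal [simp]: "ideal_pow R (mideal :: 'k::field fps set) k = filt k"
proof (induction k)
  case 0
  then show ?case by (simp add: ideal_pow_zero)
next
  case (Suc k)
  have "ideal_prod R (filt k) (filt (Suc 0)) = (filt (Suc k) :: 'k fps set)" (is "?P = _")
  proof (intro equalityI subsetI)
    fix x :: "'k fps" assume "x \<in> ?P"
    then show "x \<in> filt (Suc k)"
      by (induction rule: ideal_prod.induct) (use filt_mult[of _ k _ "Suc 0"] filt_add in auto)
  next
    fix f :: "'k fps" assume "f \<in> filt (Suc k)"
    then obtain F where F: "\<And>j. j \<in> {1..n} \<Longrightarrow> F j \<in> filt k" "f = (\<Sum>j\<in>{1..n}. F j * fps_X ^ g j)"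
      using filt_Suc_decomp by blast
    have "(\<Sum>j\<in>J. F j * fps_X ^ g j) \<in> ?P" if "J \<subseteq> {1..n}" for J
      using finite_subset[OF that finite_atLeastAtMost] that
    proof (induction J rule: finite_induct)
      case empty
      then show ?case
        using ideal_prod.prod[OF filt_zero filt_zero, of R k "Suc 0"] by simp
    next
      case (insert j J)
      then have "F j \<otimes>\<^bsub>R\<^esub> fps_X ^ g j \<in> ?P"
        using F(1)[of j] filt_monomial[OF M_gen[of j]] by (intro ideal_prod.prod) auto
      with insert show ?case using ideal_prod.sum[of _ R "filt k" "filt (Suc 0)"] by fastforce
    qed
    then show "f \<in> ?P" using F(2) by blast
  qed
  then show ?case using Suc by (simp add: ideal_pow_Suc mideal_eq)
qed

lemma reduction_number_M:
  fixes r :: nat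
  assumes "r = reduction_number R (mideal :: 'k::field fps set) (fps_X ^ g 1)"
  shows "\<forall>s \<in> M (Suc r). \<exists>s' \<in> M r. s = s' + g 1"
proof -
  let ?red = "\<lambda>r. ideal_pow R (mideal :: 'k fps set) (r + 1) = fps_X ^ g 1 <#\<^bsub>R\<^esub> ideal_pow R mideal r"
  have coset: "x <#\<^bsub>R\<^esub> (filt r :: 'k fps set) = (\<lambda>f. x * f) ` filt r" for x r
    by (auto simp: l_coset_def)
  \<comment> \<open>\<open>LEAST\<close> has its defining property only if some \<open>r\<close>
    qualifies; \<open>M_reduction\<close> provides one.\<close>
  have "\<exists>r. ?red r"
  proof -
    obtain r where r: "\<forall>s \<in> M (Suc r). \<exists>s' \<in> M r. s = s' + g 1" using M_reduction by blast
    have "f \<in> (\<lambda>f. fps_X ^ g 1 * f) ` filt r" if f: "f \<in> filt (Suc r)" for f :: "'k fps"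
    proof
      show "f = fps_X ^ g 1 * fps_shift (g 1) f"
        using f r unfolding filt_def by (intro fps_ext) (fastforce simp: fps_X_power_mult_nth)
      show "fps_shift (g 1) f \<in> filt r"
        using f r unfolding filt_def by fastforce
    qed
    moreover have "fps_X ^ g 1 * f \<in> filt (Suc r)" if "f \<in> filt r" for f :: "'k fps"
      using filt_mult[OF filt_monomial[OF M_gen[OF n_pos]] that] by simp
    ultimately have "?red r" by (auto simp: coset)
    then show ?thesis by blast
  qed
  then have "?red r" unfolding assms reduction_number_def by (rule LeastI_ex)
  then have red: "(filt (Suc r) :: 'k fps set) = (\<lambda>f. fps_X ^ g 1 * f) ` filt r"
    by (simp add: coset)
  show ?thesis
  proof
    fix s assume "s \<in> M (Suc r)"
    then have "(fps_X ^ s :: 'k fps) \<in> filt (Suc r)" by (rule filt_monomial)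
    then obtain f :: "'k fps" where f: "f \<in> filt r" "fps_X ^ s = fps_X ^ g 1 * f" using red by blast
    \<comment> \<open>This nonzero coefficient forces a term of \<open>f\<close> at
      \<open>s - g 1\<close>, an exponent in \<open>M r\<close>.\<close>
    have "(fps_X ^ s :: 'k fps) $ s = 1" by simp
    then have "g 1 \<le> s" "f $ (s - g 1) \<noteq> 0"
      unfolding f(2) fps_X_power_mult_nth by (auto split: if_splits)
    with f(1) show "\<exists>s'\<in>M r. s = s' + g 1"
      unfolding filt_def by (intro bexI[of _ "s - g 1"]) auto
  qed
qed

section \<open>Graded components as sets of residue classes\<close>

text \<open>The class of \<open>x\<close> modulo \<open>filt (Suc k)\<close>, encoded by the
  coefficients that it determines, so that equal classes are recognized coefficientwise.\<close>

definition coset :: "nat \<Rightarrow> 'k::field fps \<Rightarrow> 'k fps set" where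
  "coset k x = {y. \<forall>s. s \<notin> M (Suc k) \<longrightarrow> y $ s = x $ s}"

lemma coset_eq_iff: "coset k x = coset k y \<longleftrightarrow> (\<forall>s. s \<notin> M (Suc k) \<longrightarrow> x $ s = y $ s)"
  unfolding coset_def by (auto simp: set_eq_iff)

lemma coset_self: "x \<in> coset k x"
  by (simp add: coset_def)

lemma coset_eq_zero_iff: "coset k x = coset k 0 \<longleftrightarrow> x \<in> filt (Suc k)"
  unfolding coset_eq_iff filt_def by auto

lemma a_r_coset_filt: "filt (Suc k) +>\<^bsub>R\<^esub> x = coset k x"
proof (intro equalityI subsetI)
  fix y assume "y \<in> coset k x"
  then have "y - x \<in> filt (Suc k)" by (auto simp: coset_def filt_def)
  then show "y \<in> filt (Suc k) +>\<^bsub>R\<^esub> x"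
    by (force simp: a_r_coset_def r_coset_def intro: bexI[of _ "y - x"])
qed (auto simp: a_r_coset_def r_coset_def coset_def filt_def)

lemma filt_eq_coset: "filt (Suc k) = coset k 0"
  by (auto simp: filt_def coset_def)

abbreviation GC :: "nat \<Rightarrow> 'k::field fps set monoid" where
  "GC k \<equiv> gr_component R mideal k"

lemma GC_simps:
  fixes x y :: "'a::field fps"
  shows
  "carrier (GC k :: 'a fps set monoid) = coset k ` filt k" "\<one>\<^bsub>GC k\<^esub> = (coset k 0 :: 'a fps set)"
  "coset k x \<otimes>\<^bsub>GC k\<^esub> coset k y = coset k (x + y)"
proof -
  have "(\<Union>h\<in>filt (Suc k). {h + x}) = coset k x" for x :: "'a fps"
    using a_r_coset_filt[of k x] by (simp add: r_coset_def a_r_coset_def)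
  then show "carrier (GC k :: 'a fps set monoid) = coset k ` filt k"
    unfolding gr_component_def carrier_FactGroup by (simp add: r_coset_def)
  show "\<one>\<^bsub>GC k\<^esub> = (coset k 0 :: 'a fps set)" by (simp add: gr_component_def filt_eq_coset)
  have "z \<in> coset k (x + y) \<Longrightarrow> \<exists>a\<in>coset k x. \<exists>b\<in>coset k y. z = a + b" for z :: "'a fps"
    by (rule bexI[of _ "z - y"], rule bexI[of _ y]) (auto simp: coset_def)
  then show "coset k x \<otimes>\<^bsub>GC k\<^esub> coset k y = coset k (x + y)"
    by (auto simp: gr_component_def set_mult_def) (auto simp: coset_def)
qed

lemma comm_monoid_GC: "comm_monoid (GC k)"
  by (rule comm_monoidI) (auto simp: GC_simps filt_zero filt_add add_ac intro!: imageI)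

lemma finprod_GC:
  assumes "finite I" "\<And>i. i \<in> I \<Longrightarrow> x i \<in> filt k"
  shows "(\<Otimes>\<^bsub>GC k\<^esub>i\<in>I. coset k (x i)) = coset k (\<Sum>i\<in>I. x i)"
  using assms
proof (induction I rule: finite_induct)
  case empty
  then show ?case by (simp add: comm_monoid.finprod_empty[OF comm_monoid_GC] GC_simps)
next
  case (insert j I)
  then show ?case
    by (subst comm_monoid.finprod_insert[OF comm_monoid_GC]) (auto simp: GC_simps)
qed

lemma rcoset_mult_coset:
  assumes "x \<in> filt i" "y \<in> filt j" "i + j = k"
  shows "rcoset_mult R (filt (Suc k)) (coset i x) (coset j y) = coset k (x * y)"
proof -
  have "coset k (a * b) = coset k (x * y)" if "a \<in> coset i x" "b \<in> coset j y" for a b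
  proof -
    have a: "a - x \<in> filt (Suc i)" and b: "b - y \<in> filt (Suc j)"
      using that by (auto simp: coset_def filt_def)
    \<comment> \<open>Every term of the error has a factor one filtration step deeper, so the choice
      of representatives does not change the class.\<close>
    have "a * b - x * y = (a - x) * (b - y) + ((a - x) * y + x * (b - y))" by (simp add: algebra_simps)
    moreover have "(a - x) * (b - y) \<in> filt (Suc k)"
      using filt_mult[OF a b] filt_mono[of "Suc k" "Suc i + Suc j"] assms(3) by auto
    moreover have "(a - x) * y \<in> filt (Suc k)" "x * (b - y) \<in> filt (Suc k)"
      using filt_mult[OF a assms(2)] filt_mult[OF assms(1) b] assms(3) by auto
    ultimately have "a * b - x * y \<in> filt (Suc k)" by (simp add: filt_add)
    then show ?thesis unfolding coset_eq_iff filt_def by auto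
  qed
  then show ?thesis
    unfolding rcoset_mult_def using coset_self a_r_coset_filt by fastforce
qed


subsection \<open>Coefficients of elements of the associated graded ring\<close>

abbreviation G :: "(nat \<Rightarrow> 'k::field fps set) ring" where
  "G \<equiv> assoc_graded R mideal"

abbreviation MM :: "(nat \<Rightarrow> 'k::field fps set) set" where
  "MM \<equiv> gr_maximal R mideal"

text \<open>Computations in the graded ring are carried out on one series per degree; finiteness of
  the support is kept apart, in \<open>G_carrier_iff\<close>.\<close>

definition represents :: "(nat \<Rightarrow> 'k::field fps) \<Rightarrow> (nat \<Rightarrow> 'k fps set) \<Rightarrow> bool" where
  "represents x f \<longleftrightarrow> (\<forall>k. x k \<in> filt k \<and> f k = coset k (x k))"

lemma G_carrier_iff: "f \<in> carrier G \<longleftrightarrow> (\<exists>x. represents x f) \<and> finite {k. f k \<noteq> coset k 0}"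
proof -
  have "(\<exists>x. represents x f) \<longleftrightarrow> (\<forall>k. f k \<in> coset k ` filt k)"
    unfolding represents_def image_iff Bex_def by (simp only: choice_iff)
  then show ?thesis by (simp add: assoc_graded_def GC_simps)
qed

lemma G_zero: "\<zero>\<^bsub>G\<^esub> = (\<lambda>k. coset k 0)"
  by (simp add: assoc_graded_def GC_simps)

text \<open>For \<open>f\<close> in \<open>G\<close> the choice does not matter: the elements of \<open>f (ord s)\<close> differ by series with
  support in \<open>M (ord s + 1)\<close>, which does not contain \<open>s\<close>.\<close>

definition cf :: "(nat \<Rightarrow> 'k::field fps set) \<Rightarrow> nat \<Rightarrow> 'k" where
  "cf f s = (SOME x. x \<in> f (ord s)) $ s"

lemma not_M_Suc_ord: "s \<notin> M (Suc (ord s))"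
  using ord_ge by fastforce

lemma cf_coset: "f (ord s) = coset (ord s) x \<Longrightarrow> cf f s = x $ s"
  using someI[of "\<lambda>y. y \<in> coset (ord s) x", OF coset_self] not_M_Suc_ord
  by (simp add: cf_def coset_def)

lemma cf_represents: "represents x f \<Longrightarrow> cf f s = x (ord s) $ s"
  by (intro cf_coset) (simp add: represents_def)

lemma cf_zero: "cf \<zero>\<^bsub>G\<^esub> s = 0"
  by (simp add: G_zero cf_coset)

text \<open>In degree \<open>k\<close>, coefficients outside \<open>M k\<close> vanish and those in
  \<open>M (Suc k)\<close> are divided out. What remains are the exponents of order exactly
  \<open>k\<close>, which \<open>cf\<close> records.\<close>

lemma G_eqI:
  assumes "f \<in> carrier G" "h \<in> carrier G" and eq: "\<And>s. s \<in> S \<Longrightarrow> cf f s = cf h s"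
  shows "f = h"
proof
  fix k
  obtain x y where xy: "represents x f" "represents y h" using assms G_carrier_iff by blast
  have "x k $ s = y k $ s" if "s \<notin> M (Suc k)" for s
  proof (cases "s \<in> M k")
    case True
    then have "s \<in> S" using M_subset by blast
    moreover from this have "ord s = k"
      using M_iff_le_ord[of s k] M_iff_le_ord[of s "Suc k"] True that by simp
    ultimately show ?thesis using eq[of s] cf_represents xy by metis
  next
    case False
    then have "x k $ s = 0" "y k $ s = 0" using xy unfolding represents_def filt_def by auto
    then show ?thesis by simp
  qed
  then show "f k = h k" using xy unfolding represents_def by (simp add: coset_eq_iff)
qed

lemma represents_add: "represents x f \<Longrightarrow> represents y h \<Longrightarrow> represents (\<lambda>k. x k + y k) (f \<oplus>\<^bsub>G\<^esub> h)"
  unfolding represents_def by (simp add: assoc_graded_def GC_simps filt_add)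

lemma represents_mult:
  assumes "represents x f" "represents y h"
  shows "represents (\<lambda>k. \<Sum>i\<le>k. x i * y (k - i)) (f \<otimes>\<^bsub>G\<^esub> h)"
proof -
  have summand: "x i * y (k - i) \<in> filt k" if "i \<le> k" for i k
    using filt_mult[of "x i" i "y (k - i)" "k - i"] assms that by (simp add: represents_def)
  have "(f \<otimes>\<^bsub>G\<^esub> h) k = (\<Otimes>\<^bsub>GC k\<^esub>i\<in>{..k}. coset k (x i * y (k - i)))" for k
  proof -
    interpret comm_monoid "GC k :: 'a fps set monoid" by (rule comm_monoid_GC)
    have "(f \<otimes>\<^bsub>G\<^esub> h) k = (\<Otimes>\<^bsub>GC k\<^esub>i\<in>{..k}. rcoset_mult R (filt (Suc k)) (f i) (h (k - i)))"
      by (simp add: assoc_graded_def)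
    also have "\<dots> = (\<Otimes>\<^bsub>GC k\<^esub>i\<in>{..k}. coset k (x i * y (k - i)))"
    proof (intro finprod_cong')
      fix i assume "i \<in> {..k}"
      then show "rcoset_mult R (filt (Suc k)) (f i) (h (k - i)) = coset k (x i * y (k - i))"
        using assms rcoset_mult_coset[of "x i" i "y (k - i)" "k - i" k] by (simp add: represents_def)
    qed (use summand in \<open>auto simp: GC_simps\<close>)
    finally show ?thesis .
  qed
  then show ?thesis
    unfolding represents_def using summand finprod_GC[of "{..k}" "\<lambda>i. x i * y (k - i)" k for k]
    by (auto intro!: filt_sum)
qed

lemma G_add_closed:
  assumes "f \<in> carrier G" "h \<in> carrier G"
  shows "f \<oplus>\<^bsub>G\<^esub> h \<in> carrier G"
proof -
  have "{k. (f \<oplus>\<^bsub>G\<^esub> h) k \<noteq> coset k 0} \<subseteq> {k. f k \<noteq> coset k 0} \<union> {k. h k \<noteq> coset k 0}"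
    by (auto simp: assoc_graded_def GC_simps)
  moreover have "finite ({k. f k \<noteq> coset k 0} \<union> {k. h k \<noteq> coset k 0})"
    using assms G_carrier_iff by blast
  ultimately have "finite {k. (f \<oplus>\<^bsub>G\<^esub> h) k \<noteq> coset k 0}" by (rule finite_subset)
  then show ?thesis using assms represents_add unfolding G_carrier_iff by blast
qed

lemma G_mult_closed:
  assumes f: "f \<in> carrier G" and h: "h \<in> carrier G"
  shows "f \<otimes>\<^bsub>G\<^esub> h \<in> carrier G"
proof -
  obtain x y where xy: "represents x f" "represents y h" using assms G_carrier_iff by blast
  let ?supp = "\<lambda>f. {k. f k \<noteq> coset k 0}"
  have "?supp (f \<otimes>\<^bsub>G\<^esub> h) \<subseteq> (\<lambda>(i, j). i + j) ` (?supp f \<times> ?supp h)"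
  proof
    fix k assume k: "k \<in> ?supp (f \<otimes>\<^bsub>G\<^esub> h)"
    have "\<exists>i\<le>k. f i \<noteq> coset i 0 \<and> h (k - i) \<noteq> coset (k - i) 0"
    proof (rule ccontr)
      \<comment> \<open>If one class in every pair vanishes, its representative lies one filtration
        step deeper, and so does the whole Cauchy sum.\<close>
      assume none: "\<not> ?thesis"
      have "x i * y (k - i) \<in> filt (Suc k)" if "i \<le> k" for i
      proof -
        have "x i \<in> filt (Suc i) \<or> y (k - i) \<in> filt (Suc (k - i))"
          using none that xy unfolding represents_def by (metis coset_eq_zero_iff)
        then show ?thesis
          using xy filt_mult[of "x i" "Suc i" "y (k - i)" "k - i"]
            filt_mult[of "x i" i "y (k - i)" "Suc (k - i)"] that
          unfolding represents_def by auto
      qed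
      then have "(\<Sum>i\<le>k. x i * y (k - i)) \<in> filt (Suc k)" by (intro filt_sum) auto
      then show False
        using k represents_mult[OF xy] by (simp add: represents_def coset_eq_zero_iff)
    qed
    then show "k \<in> (\<lambda>(i, j). i + j) ` (?supp f \<times> ?supp h)" by force
  qed
  moreover have "finite (?supp f \<times> ?supp h)"
    using f h G_carrier_iff by blast
  ultimately have "finite (?supp (f \<otimes>\<^bsub>G\<^esub> h))" by (meson finite_imageI finite_subset)
  then show ?thesis using represents_mult[OF xy] G_carrier_iff by blast
qed

lemma cf_add:
  assumes "f \<in> carrier G" "h \<in> carrier G"
  shows "cf (f \<oplus>\<^bsub>G\<^esub> h) s = cf f s + cf h s"
proof -
  obtain x y where xy: "represents x f" "represents y h" using assms G_carrier_iff by blast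
  show ?thesis using cf_represents[OF represents_add[OF xy]] xy by (simp add: cf_represents)
qed

lemma cf_mult:
  assumes "f \<in> carrier G" "h \<in> carrier G" and w: "w \<in> S"
  shows "cf (f \<otimes>\<^bsub>G\<^esub> h) w =
    (\<Sum>u\<le>w. if u \<in> S \<and> w - u \<in> S \<and> ord u + ord (w - u) = ord w then cf f u * cf h (w - u) else 0)"
proof -
  obtain x y where xy: "represents x f" "represents y h" using assms G_carrier_iff by blast
  let ?P = "\<lambda>u. u \<in> S \<and> w - u \<in> S \<and> ord u + ord (w - u) = ord w"
  \<comment> \<open>A nonzero term needs \<open>u\<close> in \<open>M i\<close> and
    \<open>w - u\<close> in \<open>M (ord w - i)\<close>. Superadditivity of \<open>ord\<close> then
    leaves only \<open>i = ord u\<close>, with the orders adding up exactly.\<close>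
  have vanish: "x i $ u * y (ord w - i) $ (w - u) = 0"
    if u: "u \<le> w" and i: "i \<le> ord w" and ne: "\<not> (?P u \<and> i = ord u)" for u i
  proof (rule ccontr)
    assume "x i $ u * y (ord w - i) $ (w - u) \<noteq> 0"
    then have *: "u \<in> M i" "w - u \<in> M (ord w - i)"
      using xy unfolding represents_def filt_def by auto
    then have uS: "u \<in> S" "w - u \<in> S" using M_subset by blast+
    moreover have "i \<le> ord u" "ord w - i \<le> ord (w - u)" using * ord_ge by blast+
    moreover have "ord u + ord (w - u) \<le> ord w" using ord_add[OF uS] u by simp
    ultimately show False using ne i by auto
  qed
  have "cf (f \<otimes>\<^bsub>G\<^esub> h) w = (\<Sum>i\<in>{..ord w}. \<Sum>u\<le>w. x i $ u * y (ord w - i) $ (w - u))"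
    using cf_represents[OF represents_mult[OF xy]]
    by (simp add: fps_sum_nth fps_mult_nth atLeast0AtMost)
  also have "\<dots> = (\<Sum>u\<le>w. \<Sum>i\<in>{..ord w}. x i $ u * y (ord w - i) $ (w - u))"
    by (rule sum.swap)
  also have "\<dots> = (\<Sum>u\<le>w. if ?P u then cf f u * cf h (w - u) else 0)"
  proof (rule sum.cong)
    fix u assume "u \<in> {..w}"
    then have u: "u \<le> w" by simp
    show "(\<Sum>i\<in>{..ord w}. x i $ u * y (ord w - i) $ (w - u)) = (if ?P u then cf f u * cf h (w - u) else 0)"
    proof (cases "?P u")
      case True
      then have le: "ord u \<le> ord w" and eq: "ord w - ord u = ord (w - u)" by linarith+
      have "(\<Sum>i\<in>{..ord w}. x i $ u * y (ord w - i) $ (w - u)) =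
          (\<Sum>i\<in>{..ord w}. if i = ord u then x i $ u * y (ord w - i) $ (w - u) else 0)"
        using vanish u by (intro sum.cong) auto
      also have "\<dots> = x (ord u) $ u * y (ord (w - u)) $ (w - u)" using le eq by simp
      finally show ?thesis using True xy by (simp add: cf_represents)
    next
      case False
      then have "(\<Sum>i\<in>{..ord w}. x i $ u * y (ord w - i) $ (w - u)) = 0"
        using vanish u by (intro sum.neutral) auto
      then show ?thesis unfolding if_not_P[OF False] .
    qed
  qed simp
  finally show ?thesis .
qed

section \<open>Classes of monomials and products with them\<close>

abbreviation monomial :: "nat \<Rightarrow> (nat \<Rightarrow> 'k::field fps set)" where
  "monomial s \<equiv> monomial_class S mideal s"

lemma represents_monomial:
  assumes "s \<in> S"
  shows "represents (\<lambda>k. if k = ord s then fps_X ^ s else 0) (monomial s)"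
  using filt_monomial[OF ord_M[OF assms]] unfolding represents_def
  by (auto simp: monomial_class_def gr_class_def GC_simps a_r_coset_filt filt_zero
      simp flip: ord_def[unfolded Suc_eq_plus1[symmetric]])

lemma monomial_closed:
  assumes "s \<in> S"
  shows "(monomial s :: nat \<Rightarrow> 'k::field fps set) \<in> carrier G"
proof -
  have "(monomial s :: nat \<Rightarrow> 'k fps set) k = coset k (if k = ord s then fps_X ^ s else 0)" for k
    using represents_monomial[OF assms] unfolding represents_def by blast
  then have "{k. (monomial s :: nat \<Rightarrow> 'k fps set) k \<noteq> coset k 0} \<subseteq> {ord s}"
    by (simp add: subset_iff)
  then have "finite {k. (monomial s :: nat \<Rightarrow> 'k fps set) k \<noteq> coset k 0}" by (rule finite_subset) simp
  then show ?thesis using represents_monomial[OF assms] G_carrier_iff by blast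
qed

lemma cf_monomial: "s \<in> S \<Longrightarrow> cf (monomial s) u = (if u = s then 1 else 0)"
  by (auto simp: cf_represents[OF represents_monomial])

lemma represents_zero: "represents (\<lambda>_. 0) \<zero>\<^bsub>G\<^esub>"
  by (simp add: represents_def G_zero filt_zero)

lemma G_zero_closed: "\<zero>\<^bsub>G\<^esub> \<in> carrier G"
  unfolding G_carrier_iff using represents_zero by (auto simp: G_zero)

lemma cf_mult_monomial:
  assumes f: "f \<in> carrier G" and "v \<in> S" "w \<in> S"
  shows "cf (f \<otimes>\<^bsub>G\<^esub> monomial v) w =
    (if v \<le> w \<and> w - v \<in> S \<and> ord (w - v) + ord v = ord w then cf f (w - v) else 0)"
proof -
  have "cf (f \<otimes>\<^bsub>G\<^esub> monomial v) w =
      (\<Sum>u\<le>w. if u = w - v \<and> v \<le> w \<and> u \<in> S \<and> ord u + ord v = ord w then cf f u else 0)"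
    unfolding cf_mult[OF f monomial_closed[OF \<open>v \<in> S\<close>] \<open>w \<in> S\<close>]
    using \<open>v \<in> S\<close> by (intro sum.cong) (auto simp: cf_monomial)
  also have "\<dots> = (\<Sum>u\<le>w. if u = w - v then
      (if v \<le> w \<and> w - v \<in> S \<and> ord (w - v) + ord v = ord w then cf f (w - v) else 0) else 0)"
    by (intro sum.cong) auto
  also have "\<dots> = (if v \<le> w \<and> w - v \<in> S \<and> ord (w - v) + ord v = ord w then cf f (w - v) else 0)"
    by simp
  finally show ?thesis .
qed

lemma cf_mult_monomial_add:
  assumes "f \<in> carrier G" "u \<in> S" "v \<in> S"
  shows "cf (f \<otimes>\<^bsub>G\<^esub> monomial v) (u + v) = (if ord u + ord v = ord (u + v) then cf f u else 0)"
  using assms cf_mult_monomial[of f v "u + v"] S_add by simp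

text \<open>Each pair in the formula \<open>cf_mult\<close> either has a zero coefficient or fails
  to have additive orders.\<close>

lemma mult_eq_zero:
  assumes "f \<in> carrier G" "h \<in> carrier G"
    and less: "\<And>u v. u \<in> S \<Longrightarrow> v \<in> S \<Longrightarrow> cf f u \<noteq> 0 \<Longrightarrow> cf h v \<noteq> 0 \<Longrightarrow> ord u + ord v < ord (u + v)"
  shows "f \<otimes>\<^bsub>G\<^esub> h = \<zero>\<^bsub>G\<^esub>"
proof (rule G_eqI)
  fix w assume w: "w \<in> S"
  have "cf f u * cf h (w - u) = 0"
    if "u \<le> w" "u \<in> S" "w - u \<in> S" "ord u + ord (w - u) = ord w" for u
    using that less[of u "w - u"] by auto
  then show "cf (f \<otimes>\<^bsub>G\<^esub> h) w = cf \<zero>\<^bsub>G\<^esub> w"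
    unfolding cf_mult[OF assms(1,2) w] cf_zero by (intro sum.neutral) auto
qed (intro G_mult_closed G_zero_closed assms(1,2))+

section \<open>The homogeneous maximal ideal and its powers\<close>

lemma MM_iff: "f \<in> MM \<longleftrightarrow> f \<in> carrier G \<and> f 0 = coset 0 0"
  by (simp add: gr_maximal_def GC_simps)

lemma MM_ord: "f \<in> MM \<Longrightarrow> cf f s \<noteq> 0 \<Longrightarrow> 0 < ord s"
  using cf_coset[of f s 0] unfolding MM_iff by (cases "ord s") auto

lemma monomial_in_MM:
  assumes "s \<in> S" "0 < ord s"
  shows "(monomial s :: nat \<Rightarrow> 'k::field fps set) \<in> MM"
proof -
  have "(monomial s :: nat \<Rightarrow> 'k fps set) 0 = coset 0 (if 0 = ord s then fps_X ^ s else 0)"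
    using represents_monomial[OF assms(1)] unfolding represents_def by blast
  then show ?thesis using assms monomial_closed by (simp add: MM_iff)
qed

text \<open>Orders add along the nonzero terms of a product, and each factor from \<open>MM\<close>
  contributes at least one by \<open>MM_ord\<close>.\<close>

lemma MM_pow_ord:
  assumes "f \<in> ideal_pow G MM k"
  shows "f \<in> carrier G \<and> (\<forall>s\<in>S. cf f s \<noteq> 0 \<longrightarrow> k \<le> ord s)"
  using assms
proof (induction k arbitrary: f)
  case 0
  then show ?case by (simp add: ideal_pow_zero)
next
  case (Suc k)
  from Suc.prems[unfolded ideal_pow_Suc] show ?case
  proof (induction rule: ideal_prod.induct)
    case (prod i j)
    then have ij: "i \<in> carrier G" "j \<in> carrier G" using Suc.IH MM_iff by blast+
    have "Suc k \<le> ord w" if w: "w \<in> S" and ne: "cf (i \<otimes>\<^bsub>G\<^esub> j) w \<noteq> 0" for w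
    proof -
      obtain u where u: "u \<in> S" "w - u \<in> S" "ord u + ord (w - u) = ord w" "cf i u * cf j (w - u) \<noteq> 0"
        using ne unfolding cf_mult[OF ij w]
        by (elim sum.not_neutral_contains_not_neutral) (auto split: if_splits)
      then have "cf i u \<noteq> 0" "cf j (w - u) \<noteq> 0" by auto
      then have "k \<le> ord u" "0 < ord (w - u)" using u prod Suc.IH MM_ord by blast+
      then show ?thesis using u(3) by simp
    qed
    then show ?case using G_mult_closed[OF ij] by blast
  next
    case (sum i j)
    then show ?case using cf_add G_add_closed by (metis add_0)
  qed
qed

lemma g1_in_S: "g 1 \<in> S"
  using S_gen n_pos by blast

text \<open>Supplies test elements for annihilation by powers of \<open>MM\<close>: the orders of
  multiples of \<open>g 1\<close> add exactly, so these products of classes do not vanish.\<close>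

lemma monomial_g1_mult: "(monomial (k * g 1) :: nat \<Rightarrow> 'k::field fps set) \<in> ideal_pow G MM k"
proof (induction k)
  case 0
  then show ?case using monomial_closed S_zero by (simp add: ideal_pow_zero)
next
  case (Suc k)
  have S: "k * g 1 \<in> S" "Suc k * g 1 \<in> S" using S_mult g1_in_S by blast+
  have "ord (g 1) = 1" using ord_g1_mult[of 1] by simp
  then have "(monomial (g 1) :: nat \<Rightarrow> 'k fps set) \<in> MM"
    by (intro monomial_in_MM g1_in_S) simp
  with Suc have "monomial (k * g 1) \<otimes>\<^bsub>G\<^esub> monomial (g 1) \<in>
      ideal_pow (G :: (nat \<Rightarrow> 'k fps set) ring) MM (Suc k)"
    unfolding ideal_pow_Suc by (rule ideal_prod.prod)
  moreover have "monomial (k * g 1) \<otimes>\<^bsub>G\<^esub> monomial (g 1) = (monomial (Suc k * g 1) :: nat \<Rightarrow> 'k fps set)"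
  proof (rule G_eqI)
    fix w assume w: "w \<in> S"
    show "cf (monomial (k * g 1) \<otimes>\<^bsub>G\<^esub> monomial (g 1)) w = (cf (monomial (Suc k * g 1)) w :: 'k)"
    proof (cases "w = Suc k * g 1")
      case True
      then have "w - g 1 = k * g 1" "g 1 \<le> w" by simp_all
      moreover have "ord (k * g 1) + ord (g 1) = ord w"
        using ord_g1_mult[of k] ord_g1_mult[of "Suc k"] True \<open>ord (g 1) = 1\<close> by simp
      ultimately show ?thesis
        unfolding cf_mult_monomial[OF monomial_closed[OF S(1)] g1_in_S w] using S True
        by (simp only: cf_monomial) simp
    next
      case False
      then have "g 1 \<le> w \<Longrightarrow> w - g 1 \<noteq> k * g 1" by auto
      then show ?thesis
        unfolding cf_mult_monomial[OF monomial_closed[OF S(1)] g1_in_S w] using S False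
        by (simp only: cf_monomial) simp
    qed
  qed (intro G_mult_closed monomial_closed S g1_in_S)+
  ultimately show ?case by (simp only:)
qed


subsection \<open>Annihilators and local cohomology\<close>

text \<open>If the orders of \<open>s\<close> and \<open>k * g 1\<close> added up, multiplying
  \<open>f\<close> by the class of \<open>t^(k * g 1)\<close> would keep the coefficient
  \<open>cf f s\<close>, now at \<open>s + k * g 1\<close>.\<close>

lemma ann_pow_torsion:
  assumes f: "f \<in> ideal_annihilator G (ideal_pow G MM k)" and s: "s \<in> S" "cf f s \<noteq> 0"
  shows "torsion s"
proof -
  have "f \<in> carrier G" "f \<otimes>\<^bsub>G\<^esub> monomial (k * g 1) = \<zero>\<^bsub>G\<^esub>"
    using f monomial_g1_mult[of k] unfolding ideal_annihilator_def by blast+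
  with cf_mult_monomial_add[of f s "k * g 1"] s have "ord s + k \<noteq> ord (s + k * g 1)"
    using S_mult[OF g1_in_S, of k] ord_g1_mult[of k] by (auto simp: cf_zero)
  with ord_add_g1[OF s(1), of k] have "ord s + k < ord (s + k * g 1)" by simp
  then show ?thesis unfolding torsion_def by blast
qed

text \<open>Elements of the \<open>k\<close>-th power are supported in orders at least
  \<open>k\<close>, which meets the degree bound of \<open>torsion_ord_add\<close>.\<close>

lemma torsion_ann_pow:
  assumes r: "\<forall>s \<in> M (Suc r). \<exists>s' \<in> M r. s = s' + g 1" and "r \<le> k"
    and f: "f \<in> carrier G" "\<And>s. s \<in> S \<Longrightarrow> cf f s \<noteq> 0 \<Longrightarrow> torsion s"
  shows "f \<in> ideal_annihilator G (ideal_pow G MM k)"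
proof -
  have "f \<otimes>\<^bsub>G\<^esub> h = \<zero>\<^bsub>G\<^esub>" if h: "h \<in> ideal_pow G MM k" for h
  proof (rule mult_eq_zero)
    fix u v assume "u \<in> S" "v \<in> S" "cf f u \<noteq> 0" "cf h v \<noteq> 0"
    moreover from this have "k \<le> ord v" using MM_pow_ord[OF h] by blast
    ultimately show "ord u + ord v < ord (u + v)"
      using f(2) \<open>r \<le> k\<close> by (intro torsion_ord_add[OF r]) auto
  qed (use f MM_pow_ord[OF h] in auto)
  then show ?thesis using f(1) unfolding ideal_annihilator_def by blast
qed

lemma local_cohomology_0_eq:
  "local_cohomology_0 G MM =
    {f :: nat \<Rightarrow> 'k::field fps set. f \<in> carrier G \<and> (\<forall>s\<in>S. cf f s \<noteq> 0 \<longrightarrow> torsion s)}"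
  (is "_ = ?T")
proof (intro equalityI subsetI)
  fix f :: "nat \<Rightarrow> 'k fps set" assume "f \<in> local_cohomology_0 G MM"
  then show "f \<in> ?T"
    unfolding local_cohomology_0_def using ann_pow_torsion by (auto simp: ideal_annihilator_def)
next
  fix f :: "nat \<Rightarrow> 'k fps set" assume f: "f \<in> ?T"
  obtain r where r: "\<forall>s \<in> M (Suc r). \<exists>s' \<in> M r. s = s' + g 1" using M_reduction by blast
  \<comment> \<open>The union starts at power \<open>1\<close>, so \<open>Suc r\<close> is taken to
    cover \<open>r = 0\<close>.\<close>
  have "f \<in> ideal_annihilator G (ideal_pow G MM (Suc r))"
    using f by (intro torsion_ann_pow[OF r]) auto
  then show "f \<in> local_cohomology_0 G MM" unfolding local_cohomology_0_def by force
qed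

lemma monomial_ann_pow_iff:
  assumes r: "\<forall>s \<in> M (Suc r). \<exists>s' \<in> M r. s = s' + g 1" and s: "s \<in> S"
  shows "(monomial s :: nat \<Rightarrow> 'k::field fps set) \<in> ideal_annihilator G (ideal_pow G MM r) \<longleftrightarrow> torsion s"
proof
  assume "(monomial s :: nat \<Rightarrow> 'k fps set) \<in> ideal_annihilator G (ideal_pow G MM r)"
  from ann_pow_torsion[OF this s] show "torsion s" by (simp add: cf_monomial s)
next
  assume "torsion s"
  then show "(monomial s :: nat \<Rightarrow> 'k fps set) \<in> ideal_annihilator G (ideal_pow G MM r)"
    by (intro torsion_ann_pow[OF r] monomial_closed s) (auto simp: cf_monomial s split: if_splits)
qed

lemma monomial_ann_iff:
  assumes s: "s \<in> S"
  shows "(monomial s :: nat \<Rightarrow> 'k::field fps set) \<in> ideal_annihilator G MM \<longleftrightarrow>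
    (\<forall>u\<in>S. 0 < ord u \<longrightarrow> ord s + ord u < ord (s + u))" (is "?L \<longleftrightarrow> ?R")
proof
  assume ?L
  show ?R
  proof (intro ballI impI)
    fix u assume u: "u \<in> S" "0 < ord u"
    then have "monomial s \<otimes>\<^bsub>G\<^esub> monomial u = (\<zero>\<^bsub>G\<^esub> :: nat \<Rightarrow> 'k fps set)"
      using \<open>?L\<close> monomial_in_MM[OF u] unfolding ideal_annihilator_def by blast
    then have "ord s + ord u \<noteq> ord (s + u)"
      using cf_mult_monomial_add[OF monomial_closed[OF s] s u(1), where 'a = 'k]
      by (auto simp: cf_zero cf_monomial s)
    then show "ord s + ord u < ord (s + u)" using ord_add[OF s u(1)] by simp
  qed
next
  assume ?R
  then have "monomial s \<otimes>\<^bsub>G\<^esub> h = \<zero>\<^bsub>G\<^esub>" if "h \<in> MM" for h :: "nat \<Rightarrow> 'k fps set"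
    using MM_ord[OF that] that[unfolded MM_iff] s
    by (intro mult_eq_zero monomial_closed) (auto simp: cf_monomial split: if_splits)
  then show ?L using monomial_closed[OF s] unfolding ideal_annihilator_def by blast
qed

section \<open>The Buchsbaum property on monomials\<close>

lemma buchsbaum_iff:
  "buchsbaum (G :: (nat \<Rightarrow> 'k::field fps set) ring) MM \<longleftrightarrow>
    (\<forall>s\<in>S. torsion s \<longrightarrow> (monomial s :: nat \<Rightarrow> 'k fps set) \<in> ideal_annihilator G MM)"
  (is "?B \<longleftrightarrow> ?R")
proof
  let ?H = "local_cohomology_0 G MM :: (nat \<Rightarrow> 'k fps set) set"
  assume ?B
  show ?R
  proof (intro ballI impI)
    fix s assume s: "s \<in> S" "torsion s"
    then have H: "monomial s \<in> ?H"
      unfolding local_cohomology_0_eq by (auto simp: monomial_closed cf_monomial)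
    have "ord s + ord u < ord (s + u)" if u: "u \<in> S" "0 < ord u" for u
    proof -
      \<comment> \<open>\<open>buchsbaum\<close> puts the element of \<open>MM\<close> on the left;
        the sides are exchanged on exponents, where addition commutes.\<close>
      have "monomial u \<otimes>\<^bsub>G\<^esub> monomial s \<in> ideal_prod G MM ?H"
        using monomial_in_MM[OF u] H by (rule ideal_prod.prod)
      then have "monomial u \<otimes>\<^bsub>G\<^esub> monomial s = (\<zero>\<^bsub>G\<^esub> :: nat \<Rightarrow> 'k fps set)"
        using \<open>?B\<close> unfolding buchsbaum_def by blast
      then have "ord u + ord s \<noteq> ord (u + s)"
        using cf_mult_monomial_add[OF monomial_closed[OF u(1)] u(1) s(1), where 'a = 'k]
        by (auto simp: cf_zero cf_monomial u)
      then show ?thesis using ord_add[OF u(1) s(1)] by (simp add: add.commute)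
    qed
    then show "(monomial s :: nat \<Rightarrow> 'k fps set) \<in> ideal_annihilator G MM"
      using monomial_ann_iff s(1) by blast
  qed
next
  let ?H = "local_cohomology_0 G MM :: (nat \<Rightarrow> 'k fps set) set"
  assume ?R
  have prod_zero: "f \<otimes>\<^bsub>G\<^esub> h = \<zero>\<^bsub>G\<^esub>" if "f \<in> MM" "h \<in> ?H" for f h
  proof (rule mult_eq_zero)
    fix u v assume uv: "u \<in> S" "v \<in> S" "cf f u \<noteq> 0" "cf h v \<noteq> 0"
    then have "torsion v" using \<open>h \<in> ?H\<close> unfolding local_cohomology_0_eq by blast
    then have "(monomial v :: nat \<Rightarrow> 'k fps set) \<in> ideal_annihilator G MM" using \<open>?R\<close> uv by blast
    then have "ord v + ord u < ord (v + u)"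
      using monomial_ann_iff[OF \<open>v \<in> S\<close>] MM_ord[OF \<open>f \<in> MM\<close>] uv by blast
    then show "ord u + ord v < ord (u + v)" by (simp add: add.commute)
  qed (use that in \<open>auto simp: local_cohomology_0_eq MM_iff\<close>)
  have "f = \<zero>\<^bsub>G\<^esub>" if "f \<in> ideal_prod G MM ?H" for f
    using that
  proof (induction rule: ideal_prod.induct)
    case (sum f h)
    then show ?case by (intro G_eqI) (auto simp: cf_add cf_zero G_zero_closed G_add_closed)
  qed (rule prod_zero)
  moreover have "\<zero>\<^bsub>G\<^esub> \<in> ideal_prod G MM ?H"
  proof -
    have zero: "\<zero>\<^bsub>G\<^esub> \<in> (MM :: (nat \<Rightarrow> 'k fps set) set)" "\<zero>\<^bsub>G\<^esub> \<in> ?H"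
      by (simp_all add: MM_iff local_cohomology_0_eq G_zero_closed cf_zero) (simp add: G_zero)
    from ideal_prod.prod[OF zero, of G] prod_zero[OF zero] show ?thesis by simp
  qed
  ultimately show ?B unfolding buchsbaum_def by blast
qed

end

section \<open>From all torsion exponents to the Apery elements\<close>

theorem proposition3p6:
  fixes g :: "nat \<Rightarrow> nat" and n r :: nat and S S' :: "nat set"
    and R :: "'k::field fps ring" and m :: "'k fps set"
    and G :: "(nat \<Rightarrow> 'k fps set) ring" and MM :: "(nat \<Rightarrow> 'k fps set) set"
    and \<omega> \<omega>' b l :: "nat \<Rightarrow> nat" and a :: "nat \<Rightarrow> int"
  assumes "infinite (UNIV :: 'k set)"
    and "minimal_generators g n"
    and "S = semigroup_span (g ` {1..n})"
    and "S' = semigroup_span (insert (g 1) ((\<lambda>i. g i - g 1) ` {2..n}))"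
    and "R = semigroup_ring S"
    and "m = Idl\<^bsub>R\<^esub> ((\<lambda>i. fps_X ^ g i) ` {1..n})"
    and "r = reduction_number R m (fps_X ^ g 1)"
    and "G = assoc_graded R m"
    and "MM = gr_maximal R m"
    and "\<And>i. i < g 1 \<Longrightarrow> \<omega> i = apery S (g 1) i"
    and "\<And>i. i < g 1 \<Longrightarrow> \<omega>' i = apery S' (g 1) i"
    and "\<And>i. i < g 1 \<Longrightarrow> int (\<omega>' i) + a i * int (g 1) = int (\<omega> i)"
    and "\<And>i. i < g 1 \<Longrightarrow> b i = (GREATEST h. \<omega> i \<in> hfold S h)"
    and "\<And>i. i < g 1 \<Longrightarrow> a i > int (b i) \<Longrightarrow>
           l i = (GREATEST k. monomial_class S m (\<omega> i + k * g 1)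
                    \<in> ideal_annihilator G (ideal_pow G MM r))"
  shows "buchsbaum G MM \<longleftrightarrow>
    (\<forall>i<g 1. a i > int (b i) \<longrightarrow>
       (\<forall>k\<le>l i. monomial_class S m (\<omega> i + k * g 1) \<in> ideal_annihilator G MM))"
proof -
  interpret NS: numerical_semigroup g n S
    using assms(2,3) by unfold_locales
  have m: "m = NS.mideal" unfolding assms(5,6) NS.mideal_def ..
  note G = assms(8)[unfolded assms(5) m] and MM = assms(9)[unfolded assms(5) m]
  have r: "\<forall>s\<in>hfold S (Suc r). \<exists>s'\<in>hfold S r. s = s' + g 1"
    using NS.reduction_number_M assms(7) unfolding assms(5) m by blast
  have \<omega>: "\<omega> i \<in> S" if "i < g 1" for i
    using NS.apery_props(1) assms(10)[OF that] by simp
  \<comment> \<open>As \<open>b i\<close> is the order of \<open>\<omega> i\<close>, the condition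
    on \<open>a i\<close> and \<open>b i\<close> singles out the residue classes that contain
    torsion exponents.\<close>
  have torsion: "a i > int (b i) \<longleftrightarrow> NS.torsion (\<omega> i)" if i: "i < g 1" for i
  proof -
    have "b i = NS.ord (\<omega> i)" using assms(13)[OF i] NS.Greatest_M[OF \<omega>[OF i]] by simp
    moreover have "int (apery NS.blowup (g 1) i) + a i * int (g 1) = int (apery S (g 1) i)"
      using assms(10-12)[OF i] unfolding assms(4) NS.blowup_def by simp
    ultimately show ?thesis using NS.apery_torsion_iff assms(10)[OF i] by simp
  qed
  \<comment> \<open>Annihilation by the \<open>r\<close>-th power is torsion, so \<open>l i\<close>
    marks the last torsion exponent of the class.\<close>
  have l: "NS.torsion (\<omega> i + k * g 1) \<longleftrightarrow> k \<le> l i" if i: "i < g 1" "a i > int (b i)" for i k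
  proof -
    have "monomial_class S m (\<omega> i + k * g 1) \<in> ideal_annihilator G (ideal_pow G MM r)
        \<longleftrightarrow> NS.torsion (\<omega> i + k * g 1)" for k
      unfolding G MM m by (rule NS.monomial_ann_pow_iff[OF r NS.S_add_g1[OF \<omega>[OF i(1)]]])
    then have l_eq: "l i = (GREATEST k. NS.torsion (\<omega> i + k * g 1))"
      using assms(14)[OF i] by simp
    have "NS.torsion (\<omega> i)" using torsion i by blast
    then show ?thesis
      unfolding l_eq by (rule NS.torsion_greatest[OF r \<omega>[OF i(1)]])
  qed
  let ?ann = "\<lambda>s. monomial_class S m s \<in> ideal_annihilator G MM"
  have "buchsbaum G MM \<longleftrightarrow> (\<forall>s\<in>S. NS.torsion s \<longrightarrow> ?ann s)"
    unfolding G MM m by (rule NS.buchsbaum_iff)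
  also have "\<dots> \<longleftrightarrow> (\<forall>i<g 1. a i > int (b i) \<longrightarrow> (\<forall>k\<le>l i. ?ann (\<omega> i + k * g 1)))"
  proof (intro iffI allI ballI impI)
    fix i k assume *: "\<forall>s\<in>S. NS.torsion s \<longrightarrow> ?ann s" and "i < g 1" "a i > int (b i)" "k \<le> l i"
    then show "?ann (\<omega> i + k * g 1)" using l NS.S_add_g1[OF \<omega>] by blast
  next
    fix s assume *: "\<forall>i<g 1. a i > int (b i) \<longrightarrow> (\<forall>k\<le>l i. ?ann (\<omega> i + k * g 1))"
      and s: "s \<in> S" "NS.torsion s"
    \<comment> \<open>Torsion descends from \<open>s\<close> to the Apery element of its residue
      class, so this class is covered by the assumption, and torsion of \<open>s\<close> itself
      gives \<open>k \<le> l i\<close>.\<close>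
    define i where "i = s mod g 1"
    have i: "i < g 1" using NS.g1_pos by (simp add: i_def)
    obtain k where k: "s = \<omega> i + k * g 1"
      using NS.S_apery_decomp[OF s(1)] assms(10)[OF i] unfolding i_def by metis
    have "a i > int (b i)"
      using NS.torsion_antimono[OF \<omega>[OF i]] s(2) torsion[OF i] unfolding k by blast
    then show "?ann s" using * l[OF i, of k] s(2) i unfolding k by blast
  qed
  finally show ?thesis .
qed

end
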